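(* Let $p$ be a prime and $k \in \mathbb{Z}_{\geq 1}$. Let $P(t) \in (\mathbb{Z}/p^{k}\mathbb{Z})[t]$ be a monic polynomial whose image in $\mathbb{F}_{p}[t]$ modulo $p$ is square-free, so that by Hensel's lemma $$P(t) = P_{1}(t) \cdots P_{l}(t)$$ for some monic polynomials $P_{1}(t), \dots, P_{l}(t) \in (\mathbb{Z}/p^{k}\mathbb{Z})[t]$ whose images in $\mathbb{F}_{p}[t]$ modulo $p$ are distinct and irreducible. Then for any $n \in \mathbb{Z}_{\geq 1}$, $$\#\{X \in \mathrm{M}_{n}(\mathbb{Z}/p^{k}\mathbb{Z}) : P(X) = 0\} = p^{kn^{2}} \prod_{i=1}^{n}(1 - p^{-i}) \sum_{\substack{(n_{1}, \dots, n_{l}) \in (\mathbb{Z}_{\geq 0})^{l}: \\ n_{1}\deg(P_{1}) + \cdots + n_{l}\deg(P_{l}) = n}} \ \prod_{j=1}^{l} \frac{1}{p^{k\deg(P_{j})n_{j}^{2}}\prod_{i=1}^{n_{j}}(1 - p^{-i\deg(P_{j})})}.$$ Equivalently, for $X$ chosen uniformly at random from $\mathrm{M}_{n}(\mathbb{Z}/p^{k}\mathbb{Z})$ (dividing by $|\mathrm{M}_{n}(\mathbb{Z}/p^{k}\mathbb{Z})| = p^{kn^{2}}$), $$\mathrm{Prob}(P(X) = 0) = \prod_{i=1}^{n}(1 - p^{-i}) \sum_{\substack{(n_{1}, \dots, n_{l}) \in (\mathbb{Z}_{\geq 0})^{l}: \\ n_{1}\deg(P_{1}) + \cdots + n_{l}\deg(P_{l})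 = n}} \ \prod_{j=1}^{l} \frac{1}{p^{k\deg(P_{j})n_{j}^{2}}\prod_{i=1}^{n_{j}}(1 - p^{-i\deg(P_{j})})}.$$
   Context: $\mathrm{M}_{n}(A)$ denotes the ring of $n \times n$ matrices over a commutative ring $A$ with unity, and $\mathbb{F}_{p} = \mathbb{Z}/p\mathbb{Z}$. Empty products are equal to $1$. *)

theory Defs
  imports
    "HOL-Probability.Probability_Mass_Function"
    "HOL-Computational_Algebra.Squarefree"
    "Berlekamp_Zassenhaus.Finite_Field"
    "Jordan_Normal_Form.Matrix"
begin

text \<open>
  The ring of integers modulo \<open>m\<close> is \<open>'a mod_ring\<close> for an index type \<open>'a\<close> with \<open>CARD('a) = m\<close>;
  the class \<open>nontriv\<close> only says \<open>m > 1\<close>.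
  The map below sends the class of an integer to the class of the same integer. It is a ring
  homomorphism only if \<open>CARD('b)\<close> divides \<open>CARD('a)\<close>.
\<close>

definition reduce :: "'a::nontriv mod_ring \<Rightarrow> 'b::nontriv mod_ring" where
  "reduce x = of_int (to_int_mod_ring x)"

definition reduce_poly :: "'a::nontriv mod_ring poly \<Rightarrow> 'b::nontriv mod_ring poly" where
  "reduce_poly P = map_poly reduce P"

text \<open>
  The type argument fixes the residue field \<open>'b mod_ring\<close>.
  The factors are \<open>Q 1, \<dots>, Q l\<close>; other values of \<open>Q\<close> are irrelevant, and \<open>l = 0\<close> is
  allowed (it occurs exactly for \<open>P = 1\<close>).
\<close>

definition hensel_factorization ::
  "'b::prime_card itself \<Rightarrow> 'a::nontriv mod_ring poly \<Rightarrow> nat \<Rightarrow> (nat \<Rightarrow> 'a mod_ring poly) \<Rightarrow> bool"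
where
  "hensel_factorization _ P l Q \<longleftrightarrow>
     P = (\<Prod>j=1..l. Q j) \<and>
     (\<forall>j\<in>{1..l}. lead_coeff (Q j) = 1) \<and>
     (\<forall>j\<in>{1..l}. Factorial_Ring.irreducible (reduce_poly (Q j) :: 'b mod_ring poly)) \<and>
     inj_on (\<lambda>j. reduce_poly (Q j) :: 'b mod_ring poly) {1..l}"

text \<open>
  The value of \<open>P\<close> at a square matrix. It is written entrywise because matrices of all sizes share
  one type, so that \<open>sum\<close> is not available for them; the constant term of \<open>P\<close> multiplies the
  identity matrix \<open>X ^\<^sub>m 0\<close>.
\<close>

definition poly_mat :: "'a::comm_ring_1 poly \<Rightarrow> 'a mat \<Rightarrow> 'a mat" where
  "poly_mat P X = mat (dim_row X) (dim_row X)
     (\<lambda>ij. \<Sum>m\<le>Polynomial.degree P. Polynomial.coeff P m * (X ^\<^sub>m m) $$ ij)"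

end

theory Submission
  imports Defs "HOL-Library.Function_Algebras" "HOL-Library.Product_Plus"
begin

text \<open>
  The argument works over any finite ring \<open>R\<close> with a surjection \<open>red\<close> onto a field with \<open>q\<close>
  elements whose kernel is generated by one element \<open>\<pi>\<close> with \<open>\<pi> ^ k = 0\<close>, where \<open>R\<close> has
  \<open>q ^ k\<close> elements (locale \<open>chain_residue\<close>); the integers modulo \<open>p ^ k\<close> are the case at hand.

  A root \<open>X\<close> of \<open>P = Q 1 \<dots> Q l\<close> makes \<open>V = R^n\<close> a module over \<open>R[t]\<close> which \<open>P\<close> kills. The \<open>Q j\<close>
  are pairwise comaximal, because their residues are distinct irreducible polynomials and Bezout
  identities lift along \<open>red\<close>. So \<open>V\<close> is the direct sum of the components \<open>V j = ker (Q j)(X)\<close>.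
  Write \<open>d j\<close> for the degree of \<open>Q j\<close>. The quotient \<open>V j / \<pi> V j\<close> is a vector space over the field
  \<open>R[t] / (\<pi>, Q j)\<close> with \<open>q ^ d j\<close> elements; let \<open>r j\<close> be its dimension. By Nakayama's lemma, \<open>r j\<close>
  vectors generate \<open>V j\<close>, which bounds its size by \<open>q ^ (k * d j * r j)\<close>. The sizes of the quotients
  multiply to \<open>q ^ n\<close>, so \<open>\<Sum>j. r j * d j = n\<close>, and since \<open>V\<close> has \<open>q ^ (k * n)\<close> elements all
  these bounds are equalities. Hence the number of lists of \<open>r j\<close> generators of \<open>V j\<close> depends on
  \<open>d j\<close> and \<open>r j\<close> only: choosing the vectors one after the other outside the span of \<open>\<pi> V j\<close> and the
  earlier ones gives a product, \<open>generator_count\<close>. This is \<open>ex_type\<close>.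

  Now fix \<open>\<nu>\<close> with \<open>\<Sum>j. \<nu> j * d j = n\<close> and count the pairs of a root \<open>X\<close> and a family of generating
  lists of its components, the \<open>j\<close>-th of length \<open>\<nu> j\<close>. Applying \<open>X ^ a\<close> for \<open>a < d j\<close> to the \<open>i\<close>-th
  generator of the \<open>j\<close>-th component gives a basis of \<open>R^n\<close> indexed by the triples \<open>(j, i, a)\<close>.
  Conversely, every basis indexed by these triples comes from exactly one pair, as \<open>X\<close> has to act on
  it by the companion matrices of the \<open>Q j\<close>. So the number of pairs is the number of bases of
  \<open>R^n\<close>, whatever \<open>\<nu>\<close> is (\<open>sum_card_generating_families\<close>). Dividing by the number of families
  that belong to one root, and summing over \<open>\<nu>\<close>, gives \<open>card_roots\<close>. The bases of \<open>R^n\<close> are counted by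
  the same product, with the zero matrix and the polynomial \<open>t\<close> in place of \<open>X\<close> and \<open>Q j\<close>.

  Hensel's lemma is also obtained by counting. Multiplication maps the families of monic lifts of
  the factors to the monic lifts of their product. By comaximality it is injective, and both
  sides have \<open>q ^ (k - 1)\<close> to the power of the total degree many elements, so it is surjective.
\<close>

(* The infix *s stands for the scalar multiplication of a module below. *)
no_notation vector_scalar_mult (infixl "*s" 70)

section \<open>Counting in finite abelian groups and modules\<close>

text \<open>
  The first isomorphism theorem in terms of cardinalities, for a map that is additive only on a
  subgroup of the ambient group.
\<close>

lemma card_additive_image:
  fixes f :: "'g::ab_group_add \<Rightarrow> 'h::ab_group_add"
  assumes fin: "finite G" and zero: "0 \<in> G"
    and diff: "\<And>x y. x \<in> G \<Longrightarrow> y \<in> G \<Longrightarrow> x - y \<in> G"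
    and hom: "\<And>x y. x \<in> G \<Longrightarrow> y \<in> G \<Longrightarrow> f (x - y) = f x - f y"
  shows "card G = card (f ` G) * card {x \<in> G. f x = 0}"
proof -
  have neg: "- x \<in> G" if "x \<in> G" for x using diff[OF zero that] by simp
  have add: "x + y \<in> G" if "x \<in> G" "y \<in> G" for x y
    using diff[OF that(1) neg[OF that(2)]] by simp
  have f0: "f 0 = 0" using hom[OF zero zero] by simp
  have fneg: "f (- x) = - f x" if "x \<in> G" for x using hom[OF zero that] f0 by simp
  have fadd: "f (x + y) = f x + f y" if "x \<in> G" "y \<in> G" for x y
    using hom[OF that(1) neg[OF that(2)]] fneg[OF that(2)] by simp
  have fibre: "card {x \<in> G. f x = y} = card {x \<in> G. f x = 0}" if "y \<in> f ` G" for y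
  proof -
    from that obtain a where a: "a \<in> G" "y = f a" by auto
    have "bij_betw (\<lambda>x. x + a) {x \<in> G. f x = 0} {x \<in> G. f x = y}"
      by (rule bij_betw_byWitness[of _ "\<lambda>x. x - a"]) (auto simp: a add diff fadd hom)
    then show ?thesis by (simp add: bij_betw_same_card)
  qed
  have "card G = (\<Sum>x\<in>G. 1)" by simp
  also have "\<dots> = (\<Sum>y\<in>f ` G. \<Sum>x | x \<in> G \<and> f x = y. 1)"
    by (rule sum.image_gen[OF fin])
  also have "\<dots> = (\<Sum>y\<in>f ` G. card {x \<in> G. f x = y})" by simp
  also have "\<dots> = card (f ` G) * card {x \<in> G. f x = 0}" by (simp add: fibre)
  finally show ?thesis .
qed

context Modules.module
begin

lemma span_insert_subspace:
  assumes "subspace W"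
  shows "span (insert v W) = {w + c *s v | w c. w \<in> W}"
proof -
  have W: "span W = W" using assms by simp
  have "x - c *s v \<in> W \<longleftrightarrow> (\<exists>w\<in>W. x = w + c *s v)" for x c
    by (metis add_diff_cancel_right' diff_add_cancel)
  then show ?thesis unfolding span_insert W by auto
qed

lemma span_Un_insert: "span (W \<union> insert v S) = span (span (insert v W) \<union> S)"
  using span_superset[of "insert v W"] span_mono[of "insert v W" "W \<union> insert v S"]
    span_superset[of "W \<union> insert v S"] span_superset[of "span (insert v W) \<union> S"]
  unfolding span_eq by auto

text \<open>
  This is the first isomorphism theorem for the map \<open>(w, l) \<mapsto> w + l *s v\<close>. The set \<open>L\<close> stands for all
  scalars without being closed under multiplication: over \<open>R[t]\<close> it consists of the remainders
  modulo a monic polynomial that kills \<open>v\<close>, and so it is finite.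
\<close>

lemma card_span_insert:
  assumes W: "subspace W" "finite W"
    and L: "finite L" "0 \<in> L" "\<And>x y. x \<in> L \<Longrightarrow> y \<in> L \<Longrightarrow> x - y \<in> L"
    and cover: "\<And>c. \<exists>l\<in>L. (c - l) *s v \<in> W"
  shows "finite (span (insert v W))"
    and "card (span (insert v W)) * card {l \<in> L. l *s v \<in> W} = card W * card L"
proof -
  let ?f = "\<lambda>(w, l). w + l *s v"
  have "\<exists>w'\<in>W. \<exists>l\<in>L. w + c *s v = w' + l *s v" if "w \<in> W" for w c
  proof -
    obtain l where "l \<in> L" "(c - l) *s v \<in> W" using cover by blast
    with that W show ?thesis
      by (intro bexI[of _ "w + (c - l) *s v"] bexI[of _ l])
        (auto simp: scale_left_diff_distrib subspace_add)
  qed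
  then have img: "?f ` (W \<times> L) = span (insert v W)"
    unfolding span_insert_subspace[OF W(1)] by (fastforce simp: image_iff)
  then show "finite (span (insert v W))" using W L by (metis finite_SigmaI finite_imageI)
  \<comment> \<open>The kernel is the graph of \<open>l \<mapsto> - l *s v\<close> over the scalars that carry \<open>v\<close> into \<open>W\<close>.\<close>
  have opp: "w + l *s v = 0 \<longleftrightarrow> w = - (l *s v)" for w l by (rule eq_neg_iff_add_eq_0[symmetric])
  have "bij_betw (\<lambda>l. (- (l *s v), l)) {l \<in> L. l *s v \<in> W} {x \<in> W \<times> L. ?f x = 0}"
    by (rule bij_betw_byWitness[of _ snd])
      (use subspace_neg[OF W(1)] in \<open>auto simp: opp, (metis minus_minus)?\<close>)
  then have "card {l \<in> L. l *s v \<in> W} = card {x \<in> W \<times> L. ?f x = 0}"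
    by (rule bij_betw_same_card)
  moreover have "card (W \<times> L) = card (?f ` (W \<times> L)) * card {x \<in> W \<times> L. ?f x = 0}"
    by (rule card_additive_image)
      (use W L in \<open>auto simp: subspace_0 subspace_diff zero_prod_def scale_left_diff_distrib\<close>)
  ultimately show "card (span (insert v W)) * card {l \<in> L. l *s v \<in> W} = card W * card L"
    by (simp add: img card_cartesian_product)
qed

end

text \<open>
  The last assumption says in terms of cardinalities that \<open>V / W\<^sub>0\<close> is a vector space over a field with
  \<open>q\<close> elements. In this form neither the quotient nor the field has to be constructed; the field
  would be the extension of degree \<open>d\<close> of the residue field in the application to a component.
\<close>

locale uniform_extension = Modules.module scale
  for scale :: "'c::comm_ring_1 \<Rightarrow> 'v::ab_group_add \<Rightarrow> 'v" (infixr \<open>*s\<close> 75) +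
  fixes V W\<^sub>0 :: "'v set" and q :: nat
  assumes subspace_V: "subspace V" and finite_V: "finite V"
    and subspace_W\<^sub>0: "subspace W\<^sub>0" and W\<^sub>0_subset: "W\<^sub>0 \<subseteq> V"
    and q_pos: "q > 1"
    and card_extend: "\<And>W v. subspace W \<Longrightarrow> W\<^sub>0 \<subseteq> W \<Longrightarrow> W \<subseteq> V \<Longrightarrow> v \<in> V \<Longrightarrow> v \<notin> W
        \<Longrightarrow> card (span (insert v W)) = q * card W"
begin

lemma card_span_list_le:
  assumes "subspace W" "W\<^sub>0 \<subseteq> W" "W \<subseteq> V" "set xs \<subseteq> V"
  shows "card (span (W \<union> set xs)) \<le> card W * q ^ length xs"
  using assms
proof (induction xs arbitrary: W)
  case Nil
  then show ?case by (simp add: span_eq_iff[THEN iffD2])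
next
  case (Cons v xs)
  let ?W = "span (insert v W)"
  have sub: "W \<subseteq> ?W" using span_superset[of "insert v W"] by auto
  have "span (W \<union> set (v # xs)) = span (?W \<union> set xs)" by (simp only: list.set span_Un_insert)
  moreover have "card (span (?W \<union> set xs)) \<le> card ?W * q ^ length xs"
    using Cons.prems sub span_minimal[OF _ subspace_V, of "insert v W"] by (intro Cons.IH) auto
  moreover have "card ?W \<le> q * card W"
  proof (cases "v \<in> W")
    case True
    then show ?thesis using Cons.prems q_pos by (simp add: insert_absorb span_eq_iff[THEN iffD2])
  qed (use Cons.prems card_extend in auto)
  moreover have "card ?W * q ^ length xs \<le> q * card W * q ^ length xs"
    using \<open>card ?W \<le> q * card W\<close> by (rule mult_right_mono) simp
  ultimately have "card (span (W \<union> set (v # xs))) \<le> q * card W * q ^ length xs"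
    by (metis order.trans)
  then show ?case by (simp add: mult_ac)
qed

lemma ex_generating_list:
  assumes "subspace W" "W\<^sub>0 \<subseteq> W" "W \<subseteq> V"
  shows "\<exists>xs. set xs \<subseteq> V \<and> span (W \<union> set xs) = V \<and> card V = card W * q ^ length xs"
  using assms
proof (induction "card V - card W" arbitrary: W rule: less_induct)
  case less
  show ?case
  proof (cases "W = V")
    case True
    then show ?thesis by (intro exI[of _ "[]"]) (simp add: subspace_V)
  next
    case False
    then obtain v where v: "v \<in> V" "v \<notin> W" using less.prems by auto
    let ?W = "span (insert v W)"
    have sub: "insert v W \<subseteq> ?W" by (rule span_superset)
    have subV: "?W \<subseteq> V" using span_minimal[OF _ subspace_V] v less.prems by auto
    have "card W < card ?W"
      using v sub finite_subset[OF subV finite_V] by (intro psubset_card_mono) auto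
    moreover have "card ?W \<le> card V" using subV finite_V by (simp add: card_mono)
    ultimately have "card V - card ?W < card V - card W" by linarith
    then obtain xs where xs: "set xs \<subseteq> V" "span (?W \<union> set xs) = V"
        "card V = card ?W * q ^ length xs"
      using less.hyps[of ?W] less.prems(2) sub subV by auto
    have "span (W \<union> set (v # xs)) = span (?W \<union> set xs)"
      by (simp only: list.set span_Un_insert)
    then show ?thesis
      using xs v card_extend[OF less.prems v]
      by (intro exI[of _ "v # xs"]) (auto simp: mult_ac)
  qed
qed

text \<open>
  This counts the ordered bases of a vector space of dimension \<open>r\<close>, each entry in as many lifts as
  \<open>W\<close> has elements. The first entry lies outside \<open>W\<close>, since otherwise the remaining ones are too few
  to reach the size of \<open>V\<close>. It enlarges \<open>W\<close> by the factor \<open>q\<close>, and the induction goes on from there.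
\<close>

lemma card_generating_lists:
  assumes "subspace W" "W\<^sub>0 \<subseteq> W" "W \<subseteq> V" "card V = card W * q ^ r"
  shows "card {xs. length xs = r \<and> set xs \<subseteq> V \<and> span (W \<union> set xs) = V}
       = (\<Prod>i<r. card V - card W * q ^ i)"
  using assms
proof (induction r arbitrary: W)
  case 0
  then have "W = V" using card_subset_eq[OF finite_V] by simp
  then have "{xs. length xs = 0 \<and> set xs \<subseteq> V \<and> span (W \<union> set xs) = V} = {[]}"
    using subspace_V by (auto simp: span_eq_iff[THEN iffD2])
  then show ?case by simp
next
  case (Suc r)
  define S where "S W r = {xs. length xs = r \<and> set xs \<subseteq> V \<and> span (W \<union> set xs) = V}" for W r
  have finS: "finite (S W r)" for W r
    by (rule finite_subset[OF _ finite_lists_length_eq[OF finite_V, of r]]) (auto simp: S_def)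
  have W_pos: "card W > 0"
    using Suc.prems finite_V subspace_0[of W] by (metis card_gt_0_iff empty_iff finite_subset)
  have span_Cons: "span (W \<union> set (v # xs)) = span (span (insert v W) \<union> set xs)" for v xs
    by (simp only: list.set span_Un_insert)
  have new: "v \<notin> W" if "v # xs \<in> S W (Suc r)" for v xs
  proof
    assume "v \<in> W"
    then have "W \<union> set (v # xs) = W \<union> set xs" by auto
    then have "card V \<le> card W * q ^ r"
      using card_span_list_le[of W xs] Suc.prems that by (auto simp: S_def)
    then show False using Suc.prems W_pos q_pos by simp
  qed
  have decomp: "S W (Suc r) = (\<Union>v\<in>V - W. (#) v ` S (span (insert v W)) r)"
  proof (intro equalityI subsetI)
    fix ys assume ys: "ys \<in> S W (Suc r)"
    then obtain v xs where vxs: "ys = v # xs" by (cases ys) (auto simp: S_def)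
    then show "ys \<in> (\<Union>v\<in>V - W. (#) v ` S (span (insert v W)) r)"
      using ys new[of v xs] span_Cons[of v xs] by (auto simp: S_def)
  next
    fix ys assume "ys \<in> (\<Union>v\<in>V - W. (#) v ` S (span (insert v W)) r)"
    then show "ys \<in> S W (Suc r)" using span_Cons by (auto simp: S_def)
  qed
  have step: "card ((#) v ` S (span (insert v W)) r) = (\<Prod>i<r. card V - card W * q ^ Suc i)"
    if v: "v \<in> V - W" for v
  proof -
    have ext: "card (span (insert v W)) = q * card W" using v Suc.prems card_extend by auto
    have "W \<subseteq> span (insert v W)" using span_superset[of "insert v W"] by auto
    then have "card (S (span (insert v W)) r)
        = (\<Prod>i<r. card V - card (span (insert v W)) * q ^ i)"
      unfolding S_def
      using Suc.prems v span_minimal[OF _ subspace_V, of "insert v W"] ext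
      by (intro Suc.IH) auto
    then show ?thesis by (simp add: card_image ext mult_ac)
  qed
  have "card (S W (Suc r)) = (\<Sum>v\<in>V - W. card ((#) v ` S (span (insert v W)) r))"
    unfolding decomp by (rule card_UN_disjoint) (auto simp: finite_V finS)
  also have "\<dots> = (card V - card W) * (\<Prod>i<r. card V - card W * q ^ Suc i)"
    using step Suc.prems finite_V by (simp add: card_Diff_subset finite_subset)
  also have "\<dots> = (\<Prod>i<Suc r. card V - card W * q ^ i)"
    by (subst prod.lessThan_Suc_shift) simp
  finally show ?case by (simp only: S_def)
qed

end

section \<open>Comaximal elements\<close>

text \<open>
  The notion \<open>coprime\<close> speaks of common divisors only and is too weak here: over the integers modulo
  \<open>p ^ k\<close> with \<open>k > 1\<close>, the polynomials \<open>p\<close> and \<open>t\<close> are coprime, but they generate a proper ideal.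
\<close>

definition comaximal :: "'c::comm_ring_1 \<Rightarrow> 'c \<Rightarrow> bool" where
  "comaximal a b \<longleftrightarrow> (\<exists>u v. u * a + v * b = 1)"

lemma comaximal_1_right: "comaximal a 1"
  unfolding comaximal_def by (intro exI[of _ 0] exI[of _ 1]) simp

lemma comaximal_mult_right:
  assumes "comaximal a b" "comaximal a c"
  shows "comaximal a (b * c)"
proof -
  obtain u v u' v' where e: "u * a + v * b = 1" "u' * a + v' * c = 1"
    using assms unfolding comaximal_def by blast
  have "1 = (u * a + v * b) * (u' * a + v' * c)" using e by simp
  also have "\<dots> = (u * u' * a + u * v' * c + v * u' * b) * a + v * v' * (b * c)"
    by (simp add: algebra_simps)
  finally show ?thesis unfolding comaximal_def by metis
qed

lemma comaximal_prod_right: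
  assumes "\<And>i. i \<in> I \<Longrightarrow> comaximal a (b i)"
  shows "comaximal a (\<Prod>i\<in>I. b i)"
  using assms
proof (induction I rule: infinite_finite_induct)
  case (insert i I)
  then show ?case by (simp add: comaximal_mult_right)
qed (simp_all add: comaximal_1_right)

lemma comaximal_dvd_mult_cancel:
  assumes "comaximal a b" "a dvd b * c"
  shows "a dvd c"
proof -
  obtain u v where "u * a + v * b = 1" using assms unfolding comaximal_def by blast
  then have "c = a * (u * c) + v * (b * c)" by (metis mult.assoc mult.commute distrib_right mult_1)
  then show ?thesis using assms(2) by (metis dvd_add dvd_mult dvd_triv_left)
qed

lemma prod_dvd_of_comaximal:
  assumes "finite J" "\<And>i j. i \<in> J \<Longrightarrow> j \<in> J \<Longrightarrow> i \<noteq> j \<Longrightarrow> comaximal (a i) (a j)"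
    and "\<And>j. j \<in> J \<Longrightarrow> a j dvd z"
  shows "(\<Prod>j\<in>J. a j) dvd z"
  using assms
proof (induction J)
  case (insert j J)
  then have "(\<Prod>j\<in>J. a j) dvd z" by auto
  then obtain y where y: "z = (\<Prod>j\<in>J. a j) * y" by auto
  have "comaximal (a j) (\<Prod>j\<in>J. a j)"
    using insert.hyps insert.prems(1) by (intro comaximal_prod_right) auto
  then have "a j dvd y" using insert.prems(2)[of j] y comaximal_dvd_mult_cancel by blast
  then show ?case using insert.hyps y by (metis mult.commute mult_dvd_mono dvd_refl prod.insert)
qed auto

text \<open>
  The Chinese remainder theorem. The elements \<open>e j\<close> are orthogonal idempotents with sum \<open>1\<close> modulo
  the product of the \<open>a j\<close>, so they act as projections on every module that the product kills.
\<close>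

lemma ex_orthogonal_idempotents:
  assumes "finite J" "\<And>i j. i \<in> J \<Longrightarrow> j \<in> J \<Longrightarrow> i \<noteq> j \<Longrightarrow> comaximal (a i) (a j)"
  shows "\<exists>e. (\<forall>i\<in>J. \<forall>j\<in>J. i \<noteq> j \<longrightarrow> a i dvd e j) \<and> (\<forall>j\<in>J. a j dvd e j - 1) \<and>
    (\<Prod>j\<in>J. a j) dvd (\<Sum>j\<in>J. e j) - 1"
proof -
  have "\<exists>x. (\<forall>i\<in>J. i \<noteq> j \<longrightarrow> a i dvd x) \<and> a j dvd x - 1" if j: "j \<in> J" for j
  proof -
    have "comaximal (a j) (\<Prod>i\<in>J - {j}. a i)"
      using assms j by (intro comaximal_prod_right) auto
    then obtain u v where uv: "u * a j + v * (\<Prod>i\<in>J - {j}. a i) = 1"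
      unfolding comaximal_def by blast
    have "a i dvd v * (\<Prod>i\<in>J - {j}. a i)" if "i \<in> J" "i \<noteq> j" for i
      using assms(1) that by (intro dvd_mult dvd_prodI) auto
    moreover have "v * (\<Prod>i\<in>J - {j}. a i) - 1 = a j * (- u)"
      using uv by (simp add: algebra_simps)
    ultimately show ?thesis
      by (intro exI[of _ "v * (\<Prod>i\<in>J - {j}. a i)"]) (metis dvd_triv_left)
  qed
  then obtain e where e: "\<And>i j. j \<in> J \<Longrightarrow> i \<in> J \<Longrightarrow> i \<noteq> j \<Longrightarrow> a i dvd e j"
      "\<And>j. j \<in> J \<Longrightarrow> a j dvd e j - 1" by metis
  have "(\<Prod>j\<in>J. a j) dvd (\<Sum>j\<in>J. e j) - 1"
  proof (rule prod_dvd_of_comaximal[OF assms])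
    fix i assume i: "i \<in> J"
    have eq: "(\<Sum>j\<in>J. e j) - 1 = (e i - 1) + (\<Sum>j\<in>J - {i}. e j)"
      using i assms(1) by (simp add: sum.remove)
    have "a i dvd (\<Sum>j\<in>J - {i}. e j)" using e(1) i by (intro dvd_sum) auto
    then show "a i dvd (\<Sum>j\<in>J. e j) - 1" unfolding eq using e(2)[OF i] by (rule dvd_add[rotated])
  qed
  then show ?thesis using e by (intro exI[of _ e] conjI ballI impI) simp_all
qed

definition annihilated :: "('c \<Rightarrow> 'v \<Rightarrow> 'v) \<Rightarrow> 'v set \<Rightarrow> 'c \<Rightarrow> 'v::zero set" where
  "annihilated s U a = {u \<in> U. s a u = 0}"

context Modules.module
begin

lemma subspace_annihilated:
  assumes "subspace U"
  shows "subspace (annihilated scale U a)"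
  using assms unfolding annihilated_def subspace_def
  by (auto simp: scale_right_distrib) (metis mult.commute scale_scale scale_zero_right)

lemma dvd_scale_eq_0:
  assumes "a dvd c" "a *s u = 0"
  shows "c *s u = 0"
  using assms by (metis dvd_def mult.commute scale_scale scale_zero_right)

lemma idempotent_scale:
  assumes "a dvd e - 1" "a *s u = 0"
  shows "e *s u = u"
  using dvd_scale_eq_0[OF assms] by (simp add: scale_left_diff_distrib)

end

context Modules.module
begin

lemma ex_projections:
  assumes J: "finite J" "\<And>i j. i \<in> J \<Longrightarrow> j \<in> J \<Longrightarrow> i \<noteq> j \<Longrightarrow> comaximal (a i) (a j)"
    and U: "subspace U" and ann: "\<And>u. u \<in> U \<Longrightarrow> (\<Prod>j\<in>J. a j) *s u = 0"
  obtains e where "\<And>j u. j \<in> J \<Longrightarrow> u \<in> U \<Longrightarrow> e j *s u \<in> annihilated scale U (a j)"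
    and "\<And>i j u. i \<in> J \<Longrightarrow> j \<in> J \<Longrightarrow> u \<in> annihilated scale U (a j)
      \<Longrightarrow> e i *s u = (if i = j then u else 0)"
    and "\<And>u. u \<in> U \<Longrightarrow> (\<Sum>j\<in>J. e j *s u) = u"
proof -
  obtain e where "(\<forall>i\<in>J. \<forall>j\<in>J. i \<noteq> j \<longrightarrow> a i dvd e j) \<and> (\<forall>j\<in>J. a j dvd e j - 1) \<and>
      (\<Prod>j\<in>J. a j) dvd (\<Sum>j\<in>J. e j) - 1"
    using ex_orthogonal_idempotents[of J a, OF J] by (rule exE)
  then have e: "\<And>i j. i \<in> J \<Longrightarrow> j \<in> J \<Longrightarrow> i \<noteq> j \<Longrightarrow> a i dvd e j"
     "\<And>j. j \<in> J \<Longrightarrow> a j dvd e j - 1" "(\<Prod>j\<in>J. a j) dvd (\<Sum>j\<in>J. e j) - 1"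
    by blast+
  show ?thesis
  proof (rule that)
    fix i j u assume i: "i \<in> J" and j: "j \<in> J" and "u \<in> annihilated scale U (a j)"
    then have u: "a j *s u = 0" by (simp add: annihilated_def)
    show "e i *s u = (if i = j then u else 0)"
    proof (cases "i = j")
      case True
      then show ?thesis using idempotent_scale[OF e(2)[OF j] u] by simp
    next
      case False
      then show ?thesis using dvd_scale_eq_0[OF e(1)[OF j i] u] by simp
    qed
  next
    fix j u assume j: "j \<in> J" and u: "u \<in> U"
    have "(\<Prod>j\<in>J. a j) dvd a j * e j"
    proof (rule prod_dvd_of_comaximal[OF J])
      show "a i dvd a j * e j" if "i \<in> J" for i
        using e(1)[OF that j] by (cases "i = j") (simp_all add: dvd_mult)
    qed
    then have "(a j * e j) *s u = 0" using ann[OF u] dvd_scale_eq_0 by blast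
    then show "e j *s u \<in> annihilated scale U (a j)"
      using u U by (simp add: annihilated_def subspace_scale)
  next
    fix u assume u: "u \<in> U"
    have "(\<Sum>j\<in>J. e j *s u) = (\<Sum>j\<in>J. e j) *s u" by (simp add: scale_sum_left)
    also have "\<dots> = u" using idempotent_scale[OF e(3) ann[OF u]] .
    finally show "(\<Sum>j\<in>J. e j *s u) = u" .
  qed
qed

text \<open>
  The primary decomposition: \<open>U\<close> is the direct sum of the parts killed by the single \<open>a j\<close>.
\<close>

lemma card_eq_prod_annihilated:
  assumes J: "finite J" "\<And>i j. i \<in> J \<Longrightarrow> j \<in> J \<Longrightarrow> i \<noteq> j \<Longrightarrow> comaximal (a i) (a j)"
    and U: "subspace U" and ann: "\<And>u. u \<in> U \<Longrightarrow> (\<Prod>j\<in>J. a j) *s u = 0"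
  shows "card U = (\<Prod>j\<in>J. card (annihilated scale U (a j)))"
proof -
  obtain e where e: "\<And>j u. j \<in> J \<Longrightarrow> u \<in> U \<Longrightarrow> e j *s u \<in> annihilated scale U (a j)"
    "\<And>i j u. i \<in> J \<Longrightarrow> j \<in> J \<Longrightarrow> u \<in> annihilated scale U (a j)
      \<Longrightarrow> e i *s u = (if i = j then u else 0)"
    "\<And>u. u \<in> U \<Longrightarrow> (\<Sum>j\<in>J. e j *s u) = u"
    using ex_projections[OF J U ann] by blast
  have proj: "e i *s (\<Sum>j\<in>J. v j) = v i"
    if v: "v \<in> (\<Pi>\<^sub>E j\<in>J. annihilated scale U (a j))" and i: "i \<in> J" for v i
  proof -
    have "e i *s (\<Sum>j\<in>J. v j) = (\<Sum>j\<in>J. if i = j then v j else 0)"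
      unfolding scale_sum_right using v by (intro sum.cong[OF refl] e(2)[OF i]) auto
    then show ?thesis using i J(1) by simp
  qed
  have "bij_betw (\<lambda>v. \<Sum>j\<in>J. v j) (\<Pi>\<^sub>E j\<in>J. annihilated scale U (a j)) U"
  proof (rule bij_betw_byWitness[of _ "\<lambda>u. \<lambda>j\<in>J. e j *s u"])
    show "\<forall>v\<in>\<Pi>\<^sub>E j\<in>J. annihilated scale U (a j). (\<lambda>j\<in>J. e j *s (\<Sum>j\<in>J. v j)) = v"
    proof
      fix v assume v: "v \<in> (\<Pi>\<^sub>E j\<in>J. annihilated scale U (a j))"
      show "(\<lambda>j\<in>J. e j *s (\<Sum>j\<in>J. v j)) = v"
      proof
        fix i show "(\<lambda>j\<in>J. e j *s (\<Sum>j\<in>J. v j)) i = v i"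
          using proj[OF v, of i] PiE_arb[OF v, of i] by (cases "i \<in> J") simp_all
      qed
    qed
    show "\<forall>u\<in>U. (\<Sum>j\<in>J. (\<lambda>j\<in>J. e j *s u) j) = u" using e(3) by simp
    show "(\<lambda>v. \<Sum>j\<in>J. v j) ` (\<Pi>\<^sub>E j\<in>J. annihilated scale U (a j)) \<subseteq> U"
    proof (rule image_subsetI)
      fix v assume "v \<in> (\<Pi>\<^sub>E j\<in>J. annihilated scale U (a j))"
      then show "(\<Sum>j\<in>J. v j) \<in> U"
        by (intro subspace_sum[OF U]) (simp add: annihilated_def PiE_iff)
    qed
    show "(\<lambda>u. \<lambda>j\<in>J. e j *s u) ` U \<subseteq> (\<Pi>\<^sub>E j\<in>J. annihilated scale U (a j))"
      by (rule image_subsetI) (simp add: PiE_iff e(1))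
  qed
  from bij_betw_same_card[OF this] show ?thesis using J(1) by (simp add: card_PiE)
qed

end

section \<open>Polynomials of bounded degree and monic polynomials\<close>

lemma comaximal_of_irreducible:
  fixes g f :: "'f::field_gcd poly"
  assumes "Factorial_Ring.irreducible g" "\<not> g dvd f"
  shows "comaximal g f"
proof -
  have "prime_elem g" using assms(1) by (rule irreducible_imp_prime_elem)
  then have "coprime g f" using assms(2) by (rule prime_elem_imp_coprime)
  then have "fst (bezout_coefficients g f) * g + snd (bezout_coefficients g f) * f = 1"
    by (simp add: bezout_coefficients_fst_snd)
  then show ?thesis unfolding comaximal_def by blast
qed

text \<open>
  The functions that vanish from \<open>n\<close> on play the part of \<open>R^n\<close>: in this way the modules of all ranks
  share one type, which carries the pointwise addition.
\<close>

definition vectors :: "nat \<Rightarrow> 'c::zero set \<Rightarrow> (nat \<Rightarrow> 'c) set" where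
  "vectors n K = {f. \<forall>i. if i < n then f i \<in> K else f i = 0}"

lemma mem_vectors_iff: "f \<in> vectors n K \<longleftrightarrow> (\<forall>i<n. f i \<in> K) \<and> (\<forall>i\<ge>n. f i = 0)"
  by (auto simp: vectors_def if_bool_eq_conj not_less)

lemma
  assumes "finite K"
  shows finite_vectors: "finite (vectors n K)"
    and card_vectors: "card (vectors n K) = card K ^ n"
proof -
  have bij: "bij_betw (\<lambda>f i. if i < n then f i else 0) ({..<n} \<rightarrow>\<^sub>E K) (vectors n K)"
  proof (rule bij_betw_byWitness[of _ "\<lambda>f. restrict f {..<n}"])
    show "\<forall>f\<in>{..<n} \<rightarrow>\<^sub>E K. restrict (\<lambda>i. if i < n then f i else 0) {..<n} = f"
      by (simp add: fun_eq_iff PiE_iff extensional_def)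
    show "\<forall>f\<in>vectors n K. (\<lambda>i. if i < n then restrict f {..<n} i else 0) = f"
      by (simp add: fun_eq_iff vectors_def)
    show "(\<lambda>f i. if i < n then f i else 0) ` ({..<n} \<rightarrow>\<^sub>E K) \<subseteq> vectors n K"
      by (rule image_subsetI) (simp add: PiE_iff vectors_def)
    show "(\<lambda>f. restrict f {..<n}) ` vectors n K \<subseteq> ({..<n} \<rightarrow>\<^sub>E K)"
      by (rule image_subsetI) (simp add: PiE_iff vectors_def)
  qed
  have "finite ({..<n} \<rightarrow>\<^sub>E K)" using assms by (intro finite_PiE) auto
  then show "finite (vectors n K)" using bij bij_betw_finite by blast
  show "card (vectors n K) = card K ^ n"
    using bij_betw_same_card[OF bij] by (simp add: card_PiE)
qed

text \<open>
  With \<open>K = UNIV\<close> these are the remainders modulo a monic polynomial of degree \<open>d\<close>; with the kernel of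
  the residue map for \<open>K\<close> they are the remainders that vanish in the residue field.
\<close>

definition polys_below :: "nat \<Rightarrow> 'c::zero set \<Rightarrow> 'c poly set" where
  "polys_below d K = {f. Polynomial.coeff f \<in> vectors d K}"

lemma bij_coeff_polys_below: "bij_betw Polynomial.coeff (polys_below d K) (vectors d K)"
proof -
  have "\<exists>f. Polynomial.coeff f = c" if "c \<in> vectors d K" for c
  proof -
    have "\<forall>\<^sub>\<infinity> i. c i = 0"
      using that unfolding vectors_def MOST_nat by (intro exI[of _ d]) (auto split: if_splits)
    then show ?thesis using Abs_poly_inverse by blast
  qed
  then show ?thesis
    unfolding bij_betw_def polys_below_def by (force simp: inj_on_def poly_eq_iff)
qed

lemma
  assumes "finite K"
  shows finite_polys_below: "finite (polys_below d K)"
    and card_polys_below: "card (polys_below d K) = card K ^ d"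
proof -
  note bij = bij_coeff_polys_below[of d K]
  show "finite (polys_below d K)"
    using bij_betw_finite[OF bij] finite_vectors[OF assms] by simp
  show "card (polys_below d K) = card K ^ d"
    using bij_betw_same_card[OF bij] card_vectors[OF assms] by simp
qed

lemma polys_below_diff:
  fixes F G :: "'c::ab_group_add poly"
  shows "F \<in> polys_below d UNIV \<Longrightarrow> G \<in> polys_below d UNIV \<Longrightarrow> F - G \<in> polys_below d UNIV"
  by (auto simp: polys_below_def vectors_def)

lemma zero_in_polys_below: "0 \<in> polys_below d UNIV"
  by (simp add: polys_below_def vectors_def)

lemma mem_polys_below_UNIV:
  "f \<in> polys_below d UNIV \<longleftrightarrow> f = 0 \<or> Polynomial.degree f < d"
proof -
  have "f \<in> polys_below d UNIV \<longleftrightarrow> (\<forall>i\<ge>d. Polynomial.coeff f i = 0)"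
    by (simp add: polys_below_def vectors_def not_less[symmetric])
  also have "\<dots> \<longleftrightarrow> f = 0 \<or> Polynomial.degree f < d"
  proof
    assume *: "\<forall>i\<ge>d. Polynomial.coeff f i = 0"
    then have "\<not> Polynomial.degree f \<ge> d" if "f \<noteq> 0" using that leading_coeff_0_iff by blast
    then show "f = 0 \<or> Polynomial.degree f < d" by (cases "f = 0") auto
  qed (auto simp: coeff_eq_0)
  finally show ?thesis .
qed

lemma monic_division:
  fixes Q c :: "'c::comm_ring_1 poly"
  assumes "lead_coeff Q = 1"
  shows "\<exists>h l. l \<in> polys_below (Polynomial.degree Q) UNIV \<and> c = Q * h + l"
proof -
  obtain h l where "pseudo_divmod c Q = (h, l)" by fastforce
  moreover have "Q \<noteq> 0" using assms by auto
  ultimately have "c = Q * h + l" "l = 0 \<or> Polynomial.degree l < Polynomial.degree Q"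
    using pseudo_divmod[of Q c h l] assms by auto
  then show ?thesis using mem_polys_below_UNIV by blast
qed

lemma monic_dvd_antisym:
  fixes G H :: "'c::comm_ring_1 poly"
  assumes "lead_coeff G = 1" "lead_coeff H = 1" "Polynomial.degree G = Polynomial.degree H" "G dvd H"
  shows "G = H"
proof -
  obtain C where C: "H = G * C" using assms by auto
  then have "C \<noteq> 0" using assms by auto
  then have "Polynomial.degree H = Polynomial.degree G + Polynomial.degree C"
    using assms(1) C degree_monic_mult[of G C] by (simp add: mult.commute)
  then obtain c where c: "C = [:c:]" using assms(3) degree_eq_zeroE by auto
  then have "H = Polynomial.smult c G" using C by simp
  then have "lead_coeff H = c" using assms(1,3) by simp
  then show ?thesis using assms(2) c C by simp
qed

lemma comaximal_monic_irreducible: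
  fixes g h :: "'f::field_gcd poly"
  assumes irr: "Factorial_Ring.irreducible g" "Factorial_Ring.irreducible h"
    and mon: "lead_coeff g = 1" "lead_coeff h = 1" and ne: "g \<noteq> h"
  shows "comaximal g h"
proof (rule comaximal_of_irreducible[OF irr(1)], rule notI)
  assume dvd: "g dvd h"
  then obtain c where c: "h = g * c" by (rule dvdE)
  have nz: "g \<noteq> 0" "h \<noteq> 0" "\<not> is_unit g" using irr by (auto simp: irreducible_def)
  then have "is_unit c" using irreducibleD[OF irr(2) c] by blast
  then have "h dvd g" by (simp add: c mult_unit_dvd_iff)
  then have "Polynomial.degree g = Polynomial.degree h"
    using dvd nz by (intro antisym dvd_imp_degree_le)
  then have "g = h" using dvd mon by (intro monic_dvd_antisym)
  then show False using ne by simp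
qed

lemma squarefree_monic_factorization:
  fixes f :: "'f::field_gcd poly"
  assumes "lead_coeff f = 1" "squarefree f"
  shows "\<exists>A. finite A \<and> f = \<Prod>A \<and> (\<forall>a\<in>A. lead_coeff a = 1 \<and> Factorial_Ring.irreducible a)"
proof -
  obtain A e where A: "finite A" "f = (\<Prod>a\<in>A. a ^ Suc (e a))"
      "A \<subseteq> {g. Factorial_Ring.irreducible g \<and> lead_coeff g = 1}"
    using monic_irreducible_factorization[OF assms(1)] by auto
  have "e a = 0" if a: "a \<in> A" for a
  proof (rule ccontr)
    assume "e a \<noteq> 0"
    then have "a ^ 2 dvd a ^ Suc (e a)" by (intro le_imp_power_dvd) simp
    also have "a ^ Suc (e a) dvd f" unfolding A(2) using A(1) a by (rule dvd_prodI)
    finally have "a dvd 1" using assms(2) by (simp add: squarefree_def)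
    then show False using A(3) a by (auto simp: irreducible_def)
  qed
  then have "f = \<Prod>A" unfolding A(2) by simp
  then show ?thesis using A by blast
qed

lemma lead_coeff_prod_monic:
  fixes F :: "'j \<Rightarrow> 'c::comm_ring_1 poly"
  assumes "\<And>j. j \<in> J \<Longrightarrow> lead_coeff (F j) = 1"
  shows "lead_coeff (\<Prod>j\<in>J. F j) = 1"
  using assms
proof (induction J rule: infinite_finite_induct)
  case (insert j J)
  have "(\<Prod>j\<in>J. F j) \<noteq> 0" using insert by force
  then show ?case
    using insert degree_monic_mult[of "F j" "\<Prod>j\<in>J. F j"]
      coeff_mult_degree_sum[of "F j" "\<Prod>j\<in>J. F j"] by simp
qed simp_all

section \<open>Finite chain rings and Hensel lifting\<close>

text \<open>
  The size of the ring makes \<open>k\<close> the exact order of nilpotency of \<open>\<pi>\<close>: each of the \<open>k\<close> quotients of the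
  ideals generated by \<open>\<pi> ^ i\<close> and \<open>\<pi> ^ (i + 1)\<close> has at most \<open>q\<close> elements, hence exactly \<open>q\<close>.
\<close>

locale chain_residue = red: comm_ring_hom red
  for red :: "'a::{finite,comm_ring_1} \<Rightarrow> 'f::{finite,field_gcd}" +
  fixes \<pi> :: 'a and k q :: nat
  assumes surj_red: "surj red"
    and red_eq_0_iff: "red x = 0 \<longleftrightarrow> \<pi> dvd x"
    and pi_power: "\<pi> ^ k = 0"
    and card_field: "CARD('f) = q"
    and card_ring: "CARD('a) = q ^ k"
begin

abbreviation red_poly :: "'a poly \<Rightarrow> 'f poly" where "red_poly \<equiv> map_poly red"

sublocale red_poly: map_poly_comm_ring_hom red ..

lemma k_pos: "k > 0"
  using pi_power by (cases k) auto

lemma q_gt_1: "q > 1"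
proof -
  have "card {0, 1 :: 'f} \<le> q" unfolding card_field[symmetric] by (intro card_mono) auto
  then show ?thesis by simp
qed

lemma card_kernel: "card {x. red x = 0} = q ^ (k - 1)"
proof -
  have "CARD('a) = card (red ` UNIV) * card {x \<in> UNIV. red x = 0}"
    by (rule card_additive_image) (auto simp: red.hom_minus)
  then have "q ^ k = q * card {x. red x = 0}" using surj_red card_ring card_field by simp
  then show ?thesis using k_pos q_gt_1 by (cases k) auto
qed

lemma ex_lift: "\<exists>x. red x = y"
  using surj_red by (metis surjD)

lemma ex_lift_poly: "\<exists>F. red_poly F = f"
proof (induction f)
  case 0
  show ?case by (intro exI[of _ 0]) simp
next
  case (pCons a f)
  then obtain F where "red_poly F = f" by auto
  moreover obtain x where "red x = a" using ex_lift by auto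
  ultimately show ?case by (intro exI[of _ "pCons x F"]) (simp add: red.map_poly_pCons_hom)
qed

lemma red_poly_eq_0_imp:
  assumes "red_poly F = 0"
  shows "\<exists>G. F = Polynomial.smult \<pi> G"
  using assms
proof (induction F)
  case 0
  show ?case by (intro exI[of _ 0]) simp
next
  case (pCons a F)
  then have "red a = 0" "red_poly F = 0" by (simp_all add: red.map_poly_pCons_hom)
  then obtain x G where "a = \<pi> * x" "F = Polynomial.smult \<pi> G" using pCons.IH red_eq_0_iff by (auto elim: dvdE)
  then show ?case by (intro exI[of _ "pCons x G"]) simp
qed

text \<open>
  A lifted Bezout identity holds up to an error \<open>N\<close> with coefficients divisible by \<open>\<pi>\<close>. Then \<open>N\<close> is
  nilpotent, and the geometric sum inverts \<open>1 - N\<close>.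
\<close>

lemma comaximal_lift:
  assumes "comaximal (red_poly A) (red_poly B)"
  shows "comaximal A B"
proof -
  obtain u v where uv: "u * red_poly A + v * red_poly B = 1"
    using assms unfolding comaximal_def by blast
  obtain U V where UV: "red_poly U = u" "red_poly V = v" using ex_lift_poly by metis
  define N where "N = 1 - (U * A + V * B)"
  have "red_poly N = 0"
    unfolding N_def using uv UV by (simp add: red_poly.hom_minus red_poly.hom_add red_poly.hom_mult)
  then obtain G where "N = Polynomial.smult \<pi> G" using red_poly_eq_0_imp by blast
  then have "N ^ k = 0" by (simp add: smult_power pi_power)
  then have "1 = (1 - N) * (\<Sum>i<k. N ^ i)" using one_diff_power_eq[of N k] by simp
  also have "\<dots> = ((\<Sum>i<k. N ^ i) * U) * A + ((\<Sum>i<k. N ^ i) * V) * B"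
    unfolding N_def by (simp add: algebra_simps)
  finally show ?thesis unfolding comaximal_def by metis
qed

lemma degree_red_poly_monic:
  assumes "lead_coeff F = 1"
  shows "Polynomial.degree (red_poly F) = Polynomial.degree F"
    and "lead_coeff (red_poly F) = 1"
proof -
  have "Polynomial.coeff (red_poly F) (Polynomial.degree F) = 1"
    using assms by (simp add: red.coeff_map_poly_hom)
  then show "Polynomial.degree (red_poly F) = Polynomial.degree F"
    by (metis degree_map_poly_le le_antisym le_degree zero_neq_one)
  then show "lead_coeff (red_poly F) = 1"
    using assms by (simp add: red.coeff_map_poly_hom)
qed

lemma degree_irreducible_pos:
  assumes "lead_coeff Q = 1" "Factorial_Ring.irreducible (red_poly Q)"
  shows "Polynomial.degree Q > 0"
proof (rule ccontr)
  assume "\<not> ?thesis"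
  then obtain a where "red_poly Q = [:a:]"
    using degree_red_poly_monic(1)[OF assms(1)] by (metis degree_eq_zeroE gr0I)
  then have "red_poly Q = 1" using degree_red_poly_monic(2)[OF assms(1)] by (simp add: one_pCons)
  then show False using assms(2) by (simp add: irreducible_def)
qed

definition monic_lifts :: "'f poly \<Rightarrow> 'a poly set" where
  "monic_lifts g = {G. lead_coeff G = 1 \<and> red_poly G = g}"

lemma ex_monic_lift:
  assumes "lead_coeff g = 1"
  shows "\<exists>G. G \<in> monic_lifts g"
proof -
  let ?d = "Polynomial.degree g"
  obtain F where F: "red_poly F = g" using ex_lift_poly[of g] by blast
  \<comment> \<open>A lift of \<open>g\<close> may have too large a degree; it is truncated, and its leading term replaced.\<close>
  define G where "G = Polynomial.monom 1 ?d + (\<Sum>i<?d. Polynomial.monom (Polynomial.coeff F i) i)"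
  have coeff: "Polynomial.coeff G i = (if i = ?d then 1 else if i < ?d then Polynomial.coeff F i else 0)" for i
    unfolding G_def by (auto simp: coeff_sum sum.delta coeff_monom)
  have "Polynomial.degree G = ?d"
    using coeff by (intro antisym degree_le le_degree) auto
  then have "lead_coeff G = 1" using coeff by simp
  moreover have "red_poly G = g"
    using F assms by (auto simp: poly_eq_iff coeff coeff_eq_0)
  ultimately show ?thesis by (auto simp: monic_lifts_def)
qed

text \<open>
  Two monic lifts of \<open>g\<close> differ by a polynomial of degree below that of \<open>g\<close> with coefficients in the
  kernel of \<open>red\<close>, and this difference is arbitrary.
\<close>

lemma
  assumes "lead_coeff g = 1"
  shows finite_monic_lifts: "finite (monic_lifts g)"
    and card_monic_lifts: "card (monic_lifts g) = (q ^ (k - 1)) ^ Polynomial.degree g"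
proof -
  let ?d = "Polynomial.degree g"
  let ?N = "polys_below ?d {x. red x = 0}"
  obtain G\<^sub>0 where G\<^sub>0: "G\<^sub>0 \<in> monic_lifts g" using ex_monic_lift assms by blast
  have bij: "bij_betw (\<lambda>N. G\<^sub>0 + N) ?N (monic_lifts g)"
  proof (rule bij_betw_byWitness[of _ "\<lambda>G. G - G\<^sub>0"])
    have deg: "Polynomial.degree G = ?d" if "G \<in> monic_lifts g" for G
      using that degree_red_poly_monic(1) by (auto simp: monic_lifts_def)
    have "G - G\<^sub>0 \<in> ?N" if G: "G \<in> monic_lifts g" for G
    proof -
      have "Polynomial.coeff (G - G\<^sub>0) i = 0" if "i \<ge> ?d" for i
        using that G G\<^sub>0 deg[OF G] deg[OF G\<^sub>0] unfolding monic_lifts_def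
        by (cases "i = ?d") (auto simp: coeff_eq_0)
      moreover have "red (Polynomial.coeff (G - G\<^sub>0) i) = 0" for i
        using G G\<^sub>0 unfolding monic_lifts_def
        by (auto simp: red.hom_minus simp flip: red.coeff_map_poly_hom)
      ultimately show ?thesis by (auto simp: polys_below_def vectors_def)
    qed
    then show "(\<lambda>G. G - G\<^sub>0) ` monic_lifts g \<subseteq> ?N" by auto
    have "G\<^sub>0 + N \<in> monic_lifts g" if N: "N \<in> ?N" for N
    proof -
      have c: "Polynomial.coeff N i = 0" if "i \<ge> ?d" for i
        using N that by (auto simp: polys_below_def vectors_def split: if_splits dest: spec[of _ i])
      have r: "red (Polynomial.coeff N i) = 0" for i
        using N by (cases "i < ?d") (auto simp: polys_below_def vectors_def c dest: spec[of _ i])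
      have "Polynomial.degree (G\<^sub>0 + N) = ?d"
        using c deg[OF G\<^sub>0] G\<^sub>0 unfolding monic_lifts_def
        by (intro antisym degree_le le_degree) (auto simp: coeff_eq_0)
      moreover have "red_poly N = 0" using r by (simp add: poly_eq_iff)
      ultimately show ?thesis
        using G\<^sub>0 c deg[OF G\<^sub>0] by (auto simp: monic_lifts_def red_poly.hom_add)
    qed
    then show "(\<lambda>N. G\<^sub>0 + N) ` ?N \<subseteq> monic_lifts g" by auto
  qed auto
  have fin: "finite {x. red x = 0}" by simp
  show "finite (monic_lifts g)" using bij finite_polys_below[OF fin] bij_betw_finite by blast
  show "card (monic_lifts g) = (q ^ (k - 1)) ^ ?d"
    using bij_betw_same_card[OF bij] card_polys_below[OF fin, of ?d] by (simp add: card_kernel)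
qed

text \<open>
  The multiplication map is injective on families of monic lifts: if two families have the same
  product, then \<open>G j\<close> divides it and is comaximal with the factors \<open>H i\<close> for \<open>i \<noteq> j\<close>, so it divides the
  monic polynomial \<open>H j\<close> of the same degree. Source and target have equally many elements.
\<close>

lemma hensel_lift:
  assumes J: "finite J" and g: "\<And>j. j \<in> J \<Longrightarrow> lead_coeff (g j) = 1"
    and co: "\<And>i j. i \<in> J \<Longrightarrow> j \<in> J \<Longrightarrow> i \<noteq> j \<Longrightarrow> comaximal (g i) (g j)"
    and P: "P \<in> monic_lifts (\<Prod>j\<in>J. g j)"
  shows "\<exists>G. (\<forall>j\<in>J. G j \<in> monic_lifts (g j)) \<and> P = (\<Prod>j\<in>J. G j)"
proof -
  let ?A = "\<Pi>\<^sub>E j\<in>J. monic_lifts (g j)" and ?\<phi> = "\<lambda>G. \<Prod>j\<in>J. G j"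
  have mon: "lead_coeff (\<Prod>j\<in>J. g j) = 1" using g by (intro monic_prod) auto
  have deg: "Polynomial.degree (\<Prod>j\<in>J. g j) = (\<Sum>j\<in>J. Polynomial.degree (g j))"
    using g by (intro degree_prod_eq_sum_degree) force
  have inj: "inj_on ?\<phi> ?A"
  proof (rule inj_onI)
    fix G H assume G: "G \<in> ?A" and H: "H \<in> ?A" and eq: "?\<phi> G = ?\<phi> H"
    have "G j = H j" if j: "j \<in> J" for j
    proof (rule monic_dvd_antisym)
      have Gj: "G i \<in> monic_lifts (g i)" "H i \<in> monic_lifts (g i)" if "i \<in> J" for i
        using G H that by auto
      have "comaximal (G j) (\<Prod>i\<in>J - {j}. H i)"
        using Gj j co by (intro comaximal_prod_right comaximal_lift) (auto simp: monic_lifts_def)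
      moreover have "G j dvd (\<Prod>i\<in>J - {j}. H i) * H j"
        using j J eq by (metis dvd_prodI mult.commute prod.remove)
      ultimately show "G j dvd H j" by (rule comaximal_dvd_mult_cancel)
      show "lead_coeff (G j) = 1" "lead_coeff (H j) = 1" using Gj[OF j] by (auto simp: monic_lifts_def)
      show "Polynomial.degree (G j) = Polynomial.degree (H j)"
        using Gj[OF j] degree_red_poly_monic(1)[of "G j"] degree_red_poly_monic(1)[of "H j"]
        by (simp add: monic_lifts_def)
    qed
    then show "G = H" using G H by (intro PiE_ext[of G J _ H]) auto
  qed
  have sub: "?\<phi> ` ?A \<subseteq> monic_lifts (\<Prod>j\<in>J. g j)"
  proof (rule image_subsetI)
    fix G assume G: "G \<in> ?A"
    have "lead_coeff (\<Prod>j\<in>J. G j) = 1"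
      using G by (intro lead_coeff_prod_monic) (auto simp: monic_lifts_def PiE_iff)
    moreover have "red_poly (\<Prod>j\<in>J. G j) = (\<Prod>j\<in>J. g j)"
      using G unfolding red_poly.hom_prod by (intro prod.cong) (auto simp: monic_lifts_def PiE_iff)
    ultimately show "(\<Prod>j\<in>J. G j) \<in> monic_lifts (\<Prod>j\<in>J. g j)" by (simp add: monic_lifts_def)
  qed
  have "card (?\<phi> ` ?A) = card ?A" using inj by (rule card_image)
  also have "\<dots> = card (monic_lifts (\<Prod>j\<in>J. g j))"
    using J g mon by (simp add: card_PiE card_monic_lifts deg power_sum)
  finally have "?\<phi> ` ?A = monic_lifts (\<Prod>j\<in>J. g j)"
    using sub finite_monic_lifts[OF mon] by (intro card_subset_eq) auto
  then obtain G where "G \<in> ?A" "P = ?\<phi> G" using P by blast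
  then show ?thesis by (intro exI[of _ G]) auto
qed

lemma ex_factorization:
  assumes "lead_coeff P = 1" "squarefree (red_poly P)"
  shows "\<exists>(l::nat) Q. P = (\<Prod>j=1..l. Q j) \<and> (\<forall>j\<in>{1..l}. lead_coeff (Q j) = 1) \<and>
     (\<forall>j\<in>{1..l}. Factorial_Ring.irreducible (red_poly (Q j))) \<and>
     inj_on (\<lambda>j. red_poly (Q j)) {1..l}"
proof -
  obtain A where A: "finite A" "red_poly P = \<Prod>A"
      "\<And>a. a \<in> A \<Longrightarrow> lead_coeff a = 1 \<and> Factorial_Ring.irreducible a"
    using squarefree_monic_factorization[OF degree_red_poly_monic(2)[OF assms(1)] assms(2)] by blast
  obtain h where h: "bij_betw h {1..card A} A" using ex_bij_betw_nat_finite_1[OF A(1)] by blast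
  have hA: "h j \<in> A" if "j \<in> {1..card A}" for j using h that by (rule bij_betwE[THEN bspec])
  have "P \<in> monic_lifts (\<Prod>j=1..card A. h j)"
    using assms(1) A(2) prod.reindex_bij_betw[OF h, of "\<lambda>a. a"] by (simp add: monic_lifts_def)
  moreover have "comaximal (h i) (h j)" if "i \<in> {1..card A}" "j \<in> {1..card A}" "i \<noteq> j" for i j
    using A(3)[OF hA[OF that(1)]] A(3)[OF hA[OF that(2)]] that bij_betw_imp_inj_on[OF h]
    by (intro comaximal_monic_irreducible) (auto dest: inj_onD)
  ultimately obtain Q where Q: "\<And>j. j \<in> {1..card A} \<Longrightarrow> Q j \<in> monic_lifts (h j)"
      "P = (\<Prod>j=1..card A. Q j)"
    using hensel_lift[of "{1..card A}" h P] A(3) hA by (metis finite_atLeastAtMost)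
  then have Qh: "lead_coeff (Q j) = 1" "red_poly (Q j) = h j" if "j \<in> {1..card A}" for j
    using that by (auto simp: monic_lifts_def)
  show ?thesis
  proof (rule exI[of _ "card A"], rule exI[of _ Q], intro conjI ballI)
    show "P = (\<Prod>j=1..card A. Q j)" by (rule Q(2))
    show "lead_coeff (Q j) = 1" if "j \<in> {1..card A}" for j
      using Qh that by blast
    show "Factorial_Ring.irreducible (red_poly (Q j))" if "j \<in> {1..card A}" for j
      using A(3)[OF hA[OF that]] Qh(2)[OF that] by simp
    show "inj_on (\<lambda>j. red_poly (Q j)) {1..card A}"
    proof (rule inj_onI)
      fix i j assume ij: "i \<in> {1..card A}" "j \<in> {1..card A}" "red_poly (Q i) = red_poly (Q j)"
      then have "h i = h j" by (metis Qh(2))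
      then show "i = j" using inj_onD[OF bij_betw_imp_inj_on[OF h]] ij by blast
    qed
  qed
qed

end

section \<open>Polynomials acting through an endomorphism\<close>

locale module_endomorphism = Modules.module scale
  for scale :: "'a::comm_ring_1 \<Rightarrow> 'v::ab_group_add \<Rightarrow> 'v" (infixr \<open>*s\<close> 75) +
  fixes T :: "'v \<Rightarrow> 'v"
  assumes T_add: "T (u + v) = T u + T v"
    and T_scale: "T (c *s v) = c *s T v"
begin

lemma T_0 [simp]: "T 0 = 0"
  using T_add[of 0 0] by simp

text \<open>
  The action of \<open>F\<close> evaluated at \<open>T\<close>, by the Horner scheme, which allows induction on \<open>F\<close>.
\<close>

definition act :: "'a poly \<Rightarrow> 'v \<Rightarrow> 'v" where
  "act F v = fold_coeffs (\<lambda>a w. a *s v + T w) F 0"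

lemma act_0 [simp]: "act 0 v = 0"
  by (simp add: act_def)

lemma act_pCons [simp]: "act (pCons a F) v = a *s v + T (act F v)"
  by (cases "F = 0"; cases "a = 0") (simp_all add: act_def)

lemma act_add_left: "act (F + G) v = act F v + act G v"
proof (induction F G rule: poly_induct2)
  case (pCons a F b G)
  then show ?case by (simp add: T_add scale_left_distrib algebra_simps)
qed simp

lemma act_add_right: "act F (u + v) = act F u + act F v"
  by (induction F) (simp_all add: T_add scale_right_distrib algebra_simps)

lemma act_scale_right: "act F (c *s v) = c *s act F v"
  by (induction F) (simp_all add: T_scale scale_right_distrib mult.commute)

lemma act_smult: "act (Polynomial.smult c F) v = c *s act F v"
  by (induction F) (simp_all add: T_scale scale_right_distrib)

lemma act_mult: "act (F * G) v = act F (act G v)"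
  by (induction F) (simp_all add: act_add_left act_smult mult_pCons_left)

lemma act_1: "act 1 v = v"
  by (simp add: one_pCons)

sublocale poly_module: Modules.module act
  by unfold_locales (simp_all add: act_add_left act_add_right act_mult act_1)

lemma act_monom: "act (Polynomial.monom c m) v = c *s (T ^^ m) v"
proof (induction m)
  case (Suc m)
  then show ?case by (simp add: monom_Suc T_scale)
qed (simp add: monom_0)

lemma act_eq_sum: "act F v = (\<Sum>m\<le>Polynomial.degree F. Polynomial.coeff F m *s (T ^^ m) v)"
proof -
  have "act F v = act (\<Sum>m\<le>Polynomial.degree F. Polynomial.monom (Polynomial.coeff F m) m) v"
    by (simp add: poly_as_sum_of_monoms)
  also have "\<dots> = (\<Sum>m\<le>Polynomial.degree F. Polynomial.coeff F m *s (T ^^ m) v)"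
    by (simp only: poly_module.scale_sum_left act_monom)
  finally show ?thesis .
qed

lemma poly_subspace_iff: "poly_module.subspace W \<longleftrightarrow> subspace W \<and> (\<forall>w\<in>W. T w \<in> W)"
proof
  assume W: "poly_module.subspace W"
  have "c *s w \<in> W" if "w \<in> W" for c w
    using poly_module.subspace_scale[OF W that, of "[:c:]"] by simp
  moreover have "T w \<in> W" if "w \<in> W" for w
    using poly_module.subspace_scale[OF W that, of "[:0, 1:]"] by simp
  ultimately show "subspace W \<and> (\<forall>w\<in>W. T w \<in> W)"
    using W by (simp add: poly_module.subspace_def subspace_def)
next
  assume W: "subspace W \<and> (\<forall>w\<in>W. T w \<in> W)"
  have "act F w \<in> W" if "w \<in> W" for F w
    by (induction F) (use W that in \<open>simp_all add: subspace_0 subspace_add subspace_scale\<close>)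
  then show "poly_module.subspace W"
    using W by (simp add: poly_module.subspace_def subspace_def)
qed

definition generating_lists :: "'v set \<Rightarrow> nat \<Rightarrow> 'v list set" where
  "generating_lists U r = {xs. length xs = r \<and> set xs \<subseteq> U \<and> poly_module.span (set xs) = U}"

end

section \<open>Modules over a chain ring with an endomorphism\<close>

locale chain_endomorphism = chain_residue red \<pi> k q + module_endomorphism scale T
  for red :: "'a::{finite,comm_ring_1} \<Rightarrow> 'f::{finite,field_gcd}" and \<pi> k q
    and scale :: "'a \<Rightarrow> 'v::ab_group_add \<Rightarrow> 'v" (infixr \<open>*s\<close> 75) and T
begin

abbreviation pi_multiples :: "'v set \<Rightarrow> 'v set" where
  "pi_multiples U \<equiv> (\<lambda>u. \<pi> *s u) ` U"

lemma pi_multiples_subset: "poly_module.subspace U \<Longrightarrow> pi_multiples U \<subseteq> U"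
  by (auto simp: poly_subspace_iff subspace_scale)

lemma subspace_pi_multiples:
  assumes "poly_module.subspace U"
  shows "poly_module.subspace (pi_multiples U)"
  unfolding poly_subspace_iff
proof (intro conjI subspaceI ballI)
  have U: "subspace U" "\<And>u. u \<in> U \<Longrightarrow> T u \<in> U" using assms by (auto simp: poly_subspace_iff)
  show "0 \<in> pi_multiples U" using subspace_0[OF U(1)] by (metis imageI scale_zero_right)
  show "x + y \<in> pi_multiples U" if "x \<in> pi_multiples U" "y \<in> pi_multiples U" for x y
    using that subspace_add[OF U(1)] by (auto simp flip: scale_right_distrib)
  show "c *s x \<in> pi_multiples U" if "x \<in> pi_multiples U" for c x
    using that subspace_scale[OF U(1)] by (auto simp only: scale_left_commute[of c])
  show "T x \<in> pi_multiples U" if "x \<in> pi_multiples U" for x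
    using that U(2) by (auto simp: T_scale)
qed

text \<open>
  From \<open>U = M + \<pi> U\<close> it follows by iteration that \<open>U = M + \<pi> ^ j U\<close> for all \<open>j\<close>, and \<open>\<pi> ^ k = 0\<close>.
\<close>

lemma nakayama:
  assumes U: "poly_module.subspace U" and S: "S \<subseteq> U"
    and gen: "poly_module.span (pi_multiples U \<union> S) = U"
  shows "poly_module.span S = U"
proof
  let ?M = "poly_module.span S"
  show sub: "?M \<subseteq> U" using S U by (rule poly_module.span_minimal)
  have pi_span: "poly_module.span (pi_multiples U) = pi_multiples U"
    using subspace_pi_multiples[OF U] by simp
  have "\<forall>u\<in>U. \<exists>m\<in>?M. \<exists>u'\<in>U. u = m + \<pi> ^ j *s u'" for j
  proof (induction j)
    case 0
    show ?case
    proof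
      fix u assume "u \<in> U"
      then show "\<exists>m\<in>?M. \<exists>u'\<in>U. u = m + \<pi> ^ 0 *s u'"
        using poly_module.span_zero by (intro bexI[of _ 0] bexI[of _ u]) simp_all
    qed
  next
    case (Suc j)
    show ?case
    proof
      fix u assume "u \<in> U"
      then obtain m u' where mu: "m \<in> ?M" "u' \<in> U" "u = m + \<pi> ^ j *s u'" using Suc.IH by blast
      from mu(2) have "u' \<in> {x + y | x y. x \<in> pi_multiples U \<and> y \<in> ?M}"
        using gen poly_module.span_Un[of "pi_multiples U" S] unfolding pi_span by simp
      then obtain u'' m' where u': "u'' \<in> U" "m' \<in> ?M" "u' = \<pi> *s u'' + m'" by auto
      have "u = (m + act [:\<pi> ^ j:] m') + \<pi> ^ Suc j *s u''"
        using mu u' by (simp add: scale_right_distrib mult.commute)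
      moreover have "m + act [:\<pi> ^ j:] m' \<in> ?M"
        using mu u' by (intro poly_module.span_add poly_module.span_scale)
      ultimately show "\<exists>m\<in>?M. \<exists>u'\<in>U. u = m + \<pi> ^ Suc j *s u'" using u' by blast
    qed
  qed
  from this[of k] show "U \<subseteq> ?M" by (auto simp: pi_power)
qed

lemma nakayama_iff:
  assumes "poly_module.subspace U" "S \<subseteq> U"
  shows "poly_module.span (pi_multiples U \<union> S) = U \<longleftrightarrow> poly_module.span S = U"
proof
  assume "poly_module.span S = U"
  then have "U \<subseteq> poly_module.span (pi_multiples U \<union> S)"
    using poly_module.span_mono[of S "pi_multiples U \<union> S"] by auto
  then show "poly_module.span (pi_multiples U \<union> S) = U"
    using assms pi_multiples_subset poly_module.span_minimal[of "pi_multiples U \<union> S" U] by auto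
qed (rule nakayama[OF assms])

lemma ex_remainder_act:
  assumes "lead_coeff Q = 1" "act Q v = 0"
  shows "\<exists>l\<in>polys_below (Polynomial.degree Q) UNIV. act (F - l) v = 0"
proof -
  obtain h l where hl: "l \<in> polys_below (Polynomial.degree Q) UNIV" "F = Q * h + l"
    using monic_division[OF assms(1)] by blast
  then have "act (F - l) v = act h (act Q v)" by (simp add: act_mult[symmetric] mult.commute)
  then show ?thesis using hl(1) assms(2) by (intro bexI[of _ l]) simp_all
qed

lemma
  assumes W: "poly_module.subspace W" "finite W"
    and Q: "lead_coeff Q = 1" "act Q v = 0"
  shows finite_span_insert: "finite (poly_module.span (insert v W))"
    and card_span_insert_eq:
      "card (poly_module.span (insert v W)) *
        card {l \<in> polys_below (Polynomial.degree Q) UNIV. act l v \<in> W}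
       = card W * (q ^ k) ^ Polynomial.degree Q"
proof -
  have "\<exists>l\<in>polys_below (Polynomial.degree Q) UNIV. act (F - l) v \<in> W" for F
    using ex_remainder_act[OF Q, of F] poly_module.subspace_0[OF W(1)] by metis
  from poly_module.card_span_insert[OF W finite_polys_below zero_in_polys_below polys_below_diff this]
  show "finite (poly_module.span (insert v W))"
    and "card (poly_module.span (insert v W)) *
        card {l \<in> polys_below (Polynomial.degree Q) UNIV. act l v \<in> W}
       = card W * (q ^ k) ^ Polynomial.degree Q"
    by (simp_all add: card_polys_below card_ring)
qed

text \<open>
  The coefficients of a combination of the entries of \<open>xs\<close> can be reduced modulo \<open>Q\<close>, so there are at most
  \<open>(q ^ k) ^ d\<close> choices for each of them, where \<open>d\<close> is the degree of \<open>Q\<close>.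
\<close>

lemma card_span_le:
  assumes "lead_coeff Q = 1" "\<And>v. v \<in> set xs \<Longrightarrow> act Q v = 0"
  shows "finite (poly_module.span (set xs))
    \<and> card (poly_module.span (set xs)) \<le> ((q ^ k) ^ Polynomial.degree Q) ^ length xs"
  using assms(2)
proof (induction xs)
  case (Cons v xs)
  let ?W = "poly_module.span (set xs)"
  have eq: "poly_module.span (set (v # xs)) = poly_module.span (insert v ?W)"
    by (simp only: list.set poly_module.span_insert poly_module.span_span)
  have W: "finite ?W" "card ?W \<le> ((q ^ k) ^ Polynomial.degree Q) ^ length xs"
    using Cons.IH Cons.prems by auto
  have Q: "act Q v = 0" using Cons.prems by simp
  let ?L = "{l \<in> polys_below (Polynomial.degree Q) UNIV. act l v \<in> ?W}"
  have "0 \<in> ?L" using zero_in_polys_below poly_module.span_zero by simp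
  moreover have "finite ?L" by (simp add: finite_polys_below)
  ultimately have "card ?L \<ge> 1" by (metis One_nat_def Suc_leI card_gt_0_iff empty_iff)
  then have "card (poly_module.span (insert v ?W)) \<le> card (poly_module.span (insert v ?W)) * card ?L"
    by simp
  also have "\<dots> = card ?W * (q ^ k) ^ Polynomial.degree Q"
    using card_span_insert_eq[OF _ W(1) assms(1) Q] by simp
  also have "\<dots> \<le> ((q ^ k) ^ Polynomial.degree Q) ^ length (v # xs)"
    using W(2) by (simp add: mult.commute)
  finally show ?case using finite_span_insert[OF _ W(1) assms(1) Q] by (simp only: eq) simp
qed simp

text \<open>
  The polynomials that carry \<open>v\<close> into \<open>W\<close> form a proper ideal containing \<open>\<pi>\<close> and \<open>Q\<close>. These two generate
  a maximal ideal, so a remainder modulo \<open>Q\<close> carries \<open>v\<close> into \<open>W\<close> only if it reduces to \<open>0\<close>. This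
  happens for \<open>(q ^ (k - 1)) ^ d\<close> of the \<open>(q ^ k) ^ d\<close> remainders.
\<close>

lemma card_span_insert_irreducible:
  assumes W: "poly_module.subspace W" "finite W"
    and Q: "lead_coeff Q = 1" "Factorial_Ring.irreducible (red_poly Q)" "act Q v = 0"
    and v: "v \<notin> W" "\<And>F. \<pi> *s act F v \<in> W"
  shows "card (poly_module.span (insert v W)) = q ^ Polynomial.degree Q * card W"
proof -
  let ?d = "Polynomial.degree Q"
  have "{l \<in> polys_below ?d UNIV. act l v \<in> W} = polys_below ?d {x. red x = 0}" (is "?A = ?B")
  proof (intro equalityI subsetI)
    fix l assume l: "l \<in> ?B"
    then have "red_poly l = 0"
      by (auto simp: polys_below_def vectors_def poly_eq_iff split: if_splits)
    then obtain G where "l = Polynomial.smult \<pi> G" using red_poly_eq_0_imp by blast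
    then show "l \<in> ?A" using l v(2)[of G] by (auto simp: act_smult polys_below_def mem_vectors_iff)
  next
    fix l assume l: "l \<in> ?A"
    have "red_poly l = 0"
    proof (rule ccontr)
      assume nz: "red_poly l \<noteq> 0"
      have "Polynomial.degree l < ?d" using l nz by (auto simp: mem_polys_below_UNIV)
      then have "Polynomial.degree (red_poly l) < Polynomial.degree (red_poly Q)"
        using degree_red_poly_monic(1)[OF Q(1)] degree_map_poly_le[of red l] by simp
      then have "\<not> red_poly Q dvd red_poly l" using nz dvd_imp_degree_le leD by blast
      then have "comaximal Q l"
        using Q(2) by (intro comaximal_lift comaximal_of_irreducible)
      then obtain a b where ab: "a * Q + b * l = 1" unfolding comaximal_def by blast
      have "v = act (a * Q + b * l) v" by (simp add: ab act_1)
      also have "\<dots> = act b (act l v)" 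
        by (simp only: act_add_left act_mult Q(3) poly_module.scale_zero_right add_0_left)
      also have "\<dots> \<in> W" 
        using l poly_module.subspace_scale[OF W(1), of "act l v" b]
        by (simp del: poly_module.scale_scale)
      finally show False using v(1) by simp
    qed
    then have "red (Polynomial.coeff l i) = 0" for i by (metis coeff_0 red.coeff_map_poly_hom)
    then show "l \<in> ?B" using l by (simp add: polys_below_def mem_vectors_iff)
  qed
  then have "card ?A = (q ^ (k - 1)) ^ ?d" by (simp add: card_polys_below card_kernel)
  then have "card (poly_module.span (insert v W)) * (q ^ (k - 1)) ^ ?d = card W * (q ^ k) ^ ?d"
    using card_span_insert_eq[OF W Q(1,3)] by simp
  also have "(q ^ k) ^ ?d = q ^ ?d * (q ^ (k - 1)) ^ ?d"
    using k_pos by (cases k) (simp_all add: power_mult_distrib)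
  finally show ?thesis using q_gt_1 by (simp add: mult_ac)
qed

lemma uniform_extension_component:
  assumes U: "poly_module.subspace U" "finite U"
    and Q: "lead_coeff Q = 1" "Factorial_Ring.irreducible (red_poly Q)" "\<And>u. u \<in> U \<Longrightarrow> act Q u = 0"
  shows "uniform_extension act U (pi_multiples U) (q ^ Polynomial.degree Q)"
proof unfold_locales
  show "1 < q ^ Polynomial.degree Q"
    using q_gt_1 degree_irreducible_pos[OF Q(1,2)] by (rule one_less_power)
  fix W v assume W: "poly_module.subspace W" "pi_multiples U \<subseteq> W" "W \<subseteq> U" "v \<in> U" "v \<notin> W"
  then have "finite W" using U(2) finite_subset by blast
  then show "card (poly_module.span (insert v W)) = q ^ Polynomial.degree Q * card W"
  proof (intro card_span_insert_irreducible)
    show "\<pi> *s act F v \<in> W" for F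
      using W(2,4) poly_module.subspace_scale[OF U(1), of v F] by auto
  qed (use W Q in simp_all)
qed (simp_all add: U subspace_pi_multiples pi_multiples_subset)

text \<open>
  The number \<open>r\<close> is the dimension of \<open>U / \<pi> U\<close> over the field \<open>R[t] / (\<pi>, Q)\<close>. By Nakayama's lemma a
  list generates \<open>U\<close> as soon as it does so modulo \<open>\<pi> U\<close>.
\<close>

lemma component_rank:
  assumes U: "poly_module.subspace U" "finite U"
    and Q: "lead_coeff Q = 1" "Factorial_Ring.irreducible (red_poly Q)" "\<And>u. u \<in> U \<Longrightarrow> act Q u = 0"
  obtains r where "card U = card (pi_multiples U) * (q ^ Polynomial.degree Q) ^ r"
    and "card U \<le> ((q ^ k) ^ Polynomial.degree Q) ^ r"
    and "\<And>s. generating_lists U s \<noteq> {} \<Longrightarrow> r \<le> s"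
    and "card (generating_lists U r)
      = (\<Prod>i<r. card U - card (pi_multiples U) * (q ^ Polynomial.degree Q) ^ i)"
proof -
  interpret uniform_extension act U "pi_multiples U" "q ^ Polynomial.degree Q"
    using assms by (rule uniform_extension_component)
  have gen: "generating_lists U r =
      {xs. length xs = r \<and> set xs \<subseteq> U \<and> poly_module.span (pi_multiples U \<union> set xs) = U}" for r
    unfolding generating_lists_def using nakayama_iff[OF U(1)] by blast
  obtain xs where xs: "set xs \<subseteq> U" "poly_module.span (pi_multiples U \<union> set xs) = U"
      "card U = card (pi_multiples U) * (q ^ Polynomial.degree Q) ^ length xs"
    using ex_generating_list[OF subspace_W\<^sub>0 order.refl W\<^sub>0_subset] by blast
  have pos: "card (pi_multiples U) > 0"
    using U poly_module.subspace_0[OF U(1)] by (auto simp: card_gt_0_iff)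
  show ?thesis
  proof (rule that[of "length xs"])
    show "card U = card (pi_multiples U) * (q ^ Polynomial.degree Q) ^ length xs" by (rule xs(3))
    show "card U \<le> ((q ^ k) ^ Polynomial.degree Q) ^ length xs"
      using card_span_le[OF Q(1), of xs] xs(1,2) Q(3) nakayama_iff[OF U(1) xs(1)] by auto
    show "length xs \<le> s" if ne: "generating_lists U s \<noteq> {}" for s
    proof -
      obtain ys where ys: "length ys = s" "set ys \<subseteq> U"
          "poly_module.span (pi_multiples U \<union> set ys) = U"
        using ne unfolding gen by blast
      then have "card U \<le> card (pi_multiples U) * (q ^ Polynomial.degree Q) ^ s"
        using card_span_list_le[OF subspace_W\<^sub>0 order.refl W\<^sub>0_subset, of ys] by simp
      then have "(q ^ Polynomial.degree Q) ^ length xs \<le> (q ^ Polynomial.degree Q) ^ s"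
        using pos xs(3) by simp
      then show ?thesis using q_pos by (rule power_le_imp_le_exp[rotated])
    qed
    show "card (generating_lists U (length xs))
      = (\<Prod>i<length xs. card U - card (pi_multiples U) * (q ^ Polynomial.degree Q) ^ i)"
      unfolding gen
      by (rule card_generating_lists[OF subspace_W\<^sub>0 order.refl W\<^sub>0_subset xs(3)])
  qed
qed

end

section \<open>Matrices as endomorphisms of a free module\<close>

definition vec_scale :: "'c::comm_ring_1 \<Rightarrow> (nat \<Rightarrow> 'c) \<Rightarrow> nat \<Rightarrow> 'c" where
  "vec_scale c f = (\<lambda>i. c * f i)"

text \<open>
  Cutting off the result at \<open>n\<close> makes \<open>X\<close> an endomorphism of the module of all functions, with image
  in \<open>R^n\<close>.
\<close>

definition matrix_map :: "nat \<Rightarrow> 'c::comm_ring_1 mat \<Rightarrow> (nat \<Rightarrow> 'c) \<Rightarrow> nat \<Rightarrow> 'c" where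
  "matrix_map n X f = (\<lambda>i. if i < n then \<Sum>j<n. X $$ (i, j) * f j else 0)"

interpretation coord: Modules.module vec_scale
  by unfold_locales (simp_all add: vec_scale_def fun_eq_iff algebra_simps)

lemma module_endomorphism_matrix_map: "module_endomorphism vec_scale (matrix_map n X)"
  by unfold_locales
    (simp_all add: vec_scale_def matrix_map_def fun_eq_iff algebra_simps sum.distrib sum_distrib_left)

lemma subspace_vectors: "coord.subspace (vectors n UNIV)"
  by (auto simp: coord.subspace_def mem_vectors_iff vec_scale_def)

lemma matrix_map_in_vectors: "matrix_map n X f \<in> vectors n UNIV"
  by (simp add: mem_vectors_iff matrix_map_def)

lemma matrix_map_mult:
  assumes "A \<in> carrier_mat n n" "B \<in> carrier_mat n n"
  shows "matrix_map n (A * B) f = matrix_map n A (matrix_map n B f)"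
proof
  fix i
  show "matrix_map n (A * B) f i = matrix_map n A (matrix_map n B f) i"
  proof (cases "i < n")
    case True
    have "(\<Sum>j<n. (A * B) $$ (i, j) * f j) = (\<Sum>j<n. \<Sum>l<n. A $$ (i, l) * B $$ (l, j) * f j)"
      using assms True
      by (intro sum.cong) (auto simp: scalar_prod_def sum_distrib_right lessThan_atLeast0)
    also have "\<dots> = (\<Sum>l<n. \<Sum>j<n. A $$ (i, l) * B $$ (l, j) * f j)" by (rule sum.swap)
    finally show ?thesis using True by (simp add: matrix_map_def sum_distrib_left mult.assoc)
  qed (simp add: matrix_map_def)
qed

lemma matrix_map_one:
  assumes "f \<in> vectors n UNIV"
  shows "matrix_map n (1\<^sub>m n) f = f"
proof
  fix i
  have "(\<Sum>j<n. (1\<^sub>m n) $$ (i, j) * f j) = (\<Sum>j<n. if i = j then f j else 0)" if "i < n"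
    using that by (intro sum.cong) auto
  then show "matrix_map n (1\<^sub>m n) f i = f i"
    using assms by (auto simp: matrix_map_def mem_vectors_iff not_less)
qed

lemma matrix_map_power:
  assumes X: "X \<in> carrier_mat n n" and f: "f \<in> vectors n UNIV"
  shows "(matrix_map n X ^^ m) f = matrix_map n (X ^\<^sub>m m) f"
  using f
proof (induction m arbitrary: f)
  case 0
  then show ?case using X by (simp add: matrix_map_one)
next
  case (Suc m)
  have "(matrix_map n X ^^ Suc m) f = (matrix_map n X ^^ m) (matrix_map n X f)"
    by (simp add: funpow_swap1)
  also have "\<dots> = matrix_map n (X ^\<^sub>m m) (matrix_map n X f)"
    by (rule Suc.IH) (rule matrix_map_in_vectors)
  also have "\<dots> = matrix_map n (X ^\<^sub>m Suc m) f"
    using X by (simp add: matrix_map_mult)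
  finally show ?case .
qed

lemma matrix_map_eq_imp_eq:
  assumes "X \<in> carrier_mat n n" "Y \<in> carrier_mat n n"
    and eq: "\<And>f. f \<in> vectors n UNIV \<Longrightarrow> matrix_map n X f = matrix_map n Y f"
  shows "X = Y"
proof (rule eq_matI)
  fix i j assume "i < dim_row Y" "j < dim_col Y"
  then have ij: "i < n" "j < n" using assms by auto
  define f :: "nat \<Rightarrow> 'a" where "f = (\<lambda>l. if l = j then 1 else 0)"
  have entry: "matrix_map n Z f i = Z $$ (i, j)" for Z
    using ij by (simp add: matrix_map_def f_def if_distrib[of "\<lambda>x. _ * x"] cong: if_cong)
  have "f \<in> vectors n UNIV" using ij by (simp add: mem_vectors_iff f_def)
  then show "X $$ (i, j) = Y $$ (i, j)" using eq entry by metis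
qed (use assms in auto)

abbreviation mat_act :: "nat \<Rightarrow> 'c::comm_ring_1 mat \<Rightarrow> 'c poly \<Rightarrow> (nat \<Rightarrow> 'c) \<Rightarrow> nat \<Rightarrow> 'c" where
  "mat_act n X \<equiv> module_endomorphism.act vec_scale (matrix_map n X)"

lemma sum_fun_apply: "(\<Sum>x\<in>A. g x) i = (\<Sum>x\<in>A. g x i)"
  by (induction A rule: infinite_finite_induct) auto

lemma mat_act_eq:
  assumes X: "X \<in> carrier_mat n n" and f: "f \<in> vectors n UNIV"
  shows "mat_act n X P f = matrix_map n (poly_mat P X) f"
proof
  fix i
  interpret module_endomorphism vec_scale "matrix_map n X" by (rule module_endomorphism_matrix_map)
  let ?c = "Polynomial.coeff P" and ?d = "Polynomial.degree P"
  have "mat_act n X P f = (\<Sum>m\<le>?d. vec_scale (?c m) (matrix_map n (X ^\<^sub>m m) f))"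
    unfolding act_eq_sum using matrix_map_power[OF X f] by simp
  then have "mat_act n X P f i = (\<Sum>m\<le>?d. ?c m * matrix_map n (X ^\<^sub>m m) f i)"
    by (simp add: sum_fun_apply vec_scale_def)
  also have "\<dots> = matrix_map n (poly_mat P X) f i"
  proof (cases "i < n")
    case True
    then have "(\<Sum>m\<le>?d. ?c m * matrix_map n (X ^\<^sub>m m) f i)
      = (\<Sum>m\<le>?d. \<Sum>j<n. ?c m * (X ^\<^sub>m m) $$ (i, j) * f j)"
      by (simp add: matrix_map_def sum_distrib_left mult.assoc)
    also have "\<dots> = (\<Sum>j<n. \<Sum>m\<le>?d. ?c m * (X ^\<^sub>m m) $$ (i, j) * f j)" by (rule sum.swap)
    also have "\<dots> = matrix_map n (poly_mat P X) f i"
      using True X by (simp add: matrix_map_def poly_mat_def sum_distrib_right)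
    finally show ?thesis .
  qed (simp add: matrix_map_def)
  finally show "mat_act n X P f i = matrix_map n (poly_mat P X) f i" .
qed

lemma poly_mat_eq_0_iff:
  assumes X: "X \<in> carrier_mat n n"
  shows "poly_mat P X = 0\<^sub>m n n \<longleftrightarrow> (\<forall>f\<in>vectors n UNIV. mat_act n X P f = 0)"
proof -
  have zero: "matrix_map n (0\<^sub>m n n) f = 0" for f :: "nat \<Rightarrow> 'a"
    by (auto simp: matrix_map_def fun_eq_iff)
  have "poly_mat P X \<in> carrier_mat n n" using X by (simp add: poly_mat_def)
  then have "poly_mat P X = 0\<^sub>m n n
      \<longleftrightarrow> (\<forall>f\<in>vectors n UNIV. matrix_map n (poly_mat P X) f = matrix_map n (0\<^sub>m n n) f)"
    using matrix_map_eq_imp_eq[of "poly_mat P X" n "0\<^sub>m n n"] by auto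
  then show ?thesis using mat_act_eq[OF X] zero by simp
qed

lemma
  shows finite_carrier_mat: "finite (carrier_mat n m :: 'c::finite mat set)"
    and card_carrier_mat: "card (carrier_mat n m :: 'c::finite mat set) = CARD('c) ^ (n * m)"
proof -
  let ?F = "{..<n} \<times> {..<m} \<rightarrow>\<^sub>E (UNIV :: 'c set)"
  have bij: "bij_betw (\<lambda>f. mat n m f) ?F (carrier_mat n m)"
  proof (rule bij_betw_byWitness[of _ "\<lambda>A. restrict (($$) A) ({..<n} \<times> {..<m})"])
    show "\<forall>f\<in>?F. restrict (($$) (mat n m f)) ({..<n} \<times> {..<m}) = f"
      by (auto simp: fun_eq_iff PiE_iff extensional_def)
    show "\<forall>A\<in>carrier_mat n m. mat n m (restrict (($$) A) ({..<n} \<times> {..<m})) = A" by auto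
    show "(\<lambda>f. mat n m f) ` ?F \<subseteq> carrier_mat n m" by auto
    show "(\<lambda>A. restrict (($$) A) ({..<n} \<times> {..<m})) ` carrier_mat n m \<subseteq> ?F"
      by (intro image_subsetI) (simp add: PiE_iff)
  qed
  have fin: "finite ?F" by (intro finite_PiE) auto
  then show "finite (carrier_mat n m :: 'c mat set)" using bij bij_betw_finite by blast
  show "card (carrier_mat n m :: 'c mat set) = CARD('c) ^ (n * m)"
    using bij_betw_same_card[OF bij] by (simp add: card_PiE card_cartesian_product)
qed

lemma matrix_map_eq_on_span:
  assumes gen: "coord.span S = vectors n UNIV"
    and eq: "\<And>f. f \<in> S \<Longrightarrow> matrix_map n X f = matrix_map n Y f"
    and X: "X \<in> carrier_mat n n" and Y: "Y \<in> carrier_mat n n"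
  shows "X = Y"
proof (rule matrix_map_eq_imp_eq[OF X Y])
  interpret X: module_endomorphism vec_scale "matrix_map n X" by (rule module_endomorphism_matrix_map)
  interpret Y: module_endomorphism vec_scale "matrix_map n Y" by (rule module_endomorphism_matrix_map)
  have "coord.subspace {f. matrix_map n X f = matrix_map n Y f}"
    by (simp add: coord.subspace_def X.T_add Y.T_add X.T_scale Y.T_scale)
  then have "coord.span S \<subseteq> {f. matrix_map n X f = matrix_map n Y f}"
    using eq by (intro coord.span_minimal) auto
  then show "matrix_map n X f = matrix_map n Y f" if "f \<in> vectors n UNIV" for f
    using that gen by auto
qed

text \<open>
  A matrix is determined by its values on a generating family, and there are as many matrices as
  families of values, namely \<open>|R|\<close> to the power \<open>n * n\<close>. So every family of values occurs.
\<close>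

lemma ex_matrix_map:
  fixes b c :: "'d \<Rightarrow> nat \<Rightarrow> 'c::{finite,comm_ring_1}"
  assumes D: "finite D" "card D = n"
    and gen: "coord.span (b ` D) = vectors n UNIV"
    and c: "\<And>d. d \<in> D \<Longrightarrow> c d \<in> vectors n UNIV"
  shows "\<exists>X\<in>carrier_mat n n. \<forall>d\<in>D. matrix_map n X (b d) = c d"
proof -
  let ?V = "vectors n (UNIV :: 'c set)"
  let ?\<phi> = "\<lambda>X. \<lambda>d\<in>D. matrix_map n X (b d)"
  have inj: "inj_on ?\<phi> (carrier_mat n n)"
  proof (rule inj_onI)
    fix X Y assume XY: "X \<in> carrier_mat n n" "Y \<in> carrier_mat n n" and eq: "?\<phi> X = ?\<phi> Y"
    have "matrix_map n X (b d) = matrix_map n Y (b d)" if "d \<in> D" for d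
      using fun_cong[OF eq, of d] that by simp
    then show "X = Y" using XY by (intro matrix_map_eq_on_span[OF gen]) auto
  qed
  have sub: "?\<phi> ` carrier_mat n n \<subseteq> (D \<rightarrow>\<^sub>E ?V)"
    by (intro image_subsetI) (simp add: PiE_iff matrix_map_in_vectors)
  have finV: "finite ?V" "card ?V = CARD('c) ^ n"
    by (simp_all add: finite_vectors card_vectors)
  have "card (?\<phi> ` carrier_mat n n) = CARD('c) ^ (n * n)"
    using card_image[OF inj] card_carrier_mat by metis
  also have "\<dots> = card (D \<rightarrow>\<^sub>E ?V)" using D finV by (simp add: card_PiE power_mult)
  finally have "?\<phi> ` carrier_mat n n = (D \<rightarrow>\<^sub>E ?V)"
    using sub D finV by (intro card_subset_eq finite_PiE) auto
  then have "restrict c D \<in> ?\<phi> ` carrier_mat n n" using c by auto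
  then obtain X where X: "restrict c D = ?\<phi> X" "X \<in> carrier_mat n n" by (rule imageE)
  show ?thesis
  proof (intro bexI[OF _ X(2)] ballI)
    show "matrix_map n X (b d) = c d" if "d \<in> D" for d
      using fun_cong[OF X(1), of d] that by simp
  qed
qed

section \<open>The type of a root\<close>

lemma prod_le_eq_imp_eq:
  fixes f g :: "'j \<Rightarrow> nat"
  assumes J: "finite J" and le: "\<And>j. j \<in> J \<Longrightarrow> f j \<le> g j" and pos: "\<And>j. j \<in> J \<Longrightarrow> g j > 0"
    and eq: "(\<Prod>j\<in>J. f j) = (\<Prod>j\<in>J. g j)" and i: "i \<in> J"
  shows "f i = g i"
proof (rule ccontr)
  assume "f i \<noteq> g i"
  then have lt: "f i < g i" using le[OF i] by simp
  have "(\<Prod>j\<in>J. f j) = f i * (\<Prod>j\<in>J - {i}. f j)" using J i by (rule prod.remove)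
  also have "\<dots> \<le> f i * (\<Prod>j\<in>J - {i}. g j)" using le by (intro mult_le_mono2 prod_mono) auto
  also have "\<dots> < g i * (\<Prod>j\<in>J - {i}. g j)"
  proof -
    have "(\<Prod>j\<in>J - {i}. g j) > 0" using pos by (intro prod_pos) auto
    then show ?thesis using lt by simp
  qed
  also have "\<dots> = (\<Prod>j\<in>J. g j)" using prod.remove[OF J i, of g] by simp
  finally show False using eq by simp
qed

lemma sum_le_eq_imp_eq:
  fixes f g w :: "'j \<Rightarrow> nat"
  assumes J: "finite J" and le: "\<And>j. j \<in> J \<Longrightarrow> f j \<le> g j" and pos: "\<And>j. j \<in> J \<Longrightarrow> w j > 0"
    and eq: "(\<Sum>j\<in>J. f j * w j) = (\<Sum>j\<in>J. g j * w j)" and i: "i \<in> J"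
  shows "f i = g i"
proof (rule ccontr)
  assume "f i \<noteq> g i"
  then have "f i * w i < g i * w i" using le[OF i] pos[OF i] by simp
  then have "(\<Sum>j\<in>J. f j * w j) < (\<Sum>j\<in>J. g j * w j)"
    using J le i by (intro sum_strict_mono_ex1) (auto intro!: bexI[of _ i])
  then show False using eq by simp
qed

context chain_residue
begin

lemma chain_endomorphism_matrix: "chain_endomorphism red \<pi> k q vec_scale (matrix_map n X)"
  using chain_residue_axioms module_endomorphism_matrix_map by (rule chain_endomorphism.intro)

lemma finite_space: "finite (vectors n (UNIV :: 'a set))"
  by (simp add: finite_vectors)

lemma card_space: "card (vectors n (UNIV :: 'a set)) = (q ^ k) ^ n"
  by (simp add: card_vectors card_ring)

lemma pi_multiples_space: "vec_scale \<pi> ` vectors n UNIV = vectors n {x. red x = 0}"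
proof (intro equalityI subsetI)
  fix f assume "f \<in> vec_scale \<pi> ` vectors n UNIV"
  then show "f \<in> vectors n {x. red x = 0}"
    by (auto simp: mem_vectors_iff vec_scale_def red_eq_0_iff)
next
  fix f assume f: "f \<in> vectors n {x. red x = 0}"
  then have "\<forall>i. \<exists>y. i < n \<longrightarrow> f i = \<pi> * y" by (auto simp: mem_vectors_iff red_eq_0_iff dvd_def)
  then obtain g where g: "\<And>i. i < n \<Longrightarrow> f i = \<pi> * g i" by metis
  have "f = vec_scale \<pi> (\<lambda>i. if i < n then g i else 0)"
    using f g by (auto simp: fun_eq_iff vec_scale_def mem_vectors_iff)
  moreover have "(\<lambda>i. if i < n then g i else 0) \<in> vectors n UNIV" by (simp add: mem_vectors_iff)
  ultimately show "f \<in> vec_scale \<pi> ` vectors n UNIV" by blast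
qed

lemma card_pi_multiples_space: "card (vec_scale \<pi> ` vectors n UNIV) = (q ^ (k - 1)) ^ n"
  by (simp add: pi_multiples_space card_vectors card_kernel)

text \<open>
  The number of generating lists of length \<open>m\<close> of a component of size \<open>q ^ (k * d * m)\<close>; for \<open>d = 1\<close> it
  is the order of the general linear group of rank \<open>m\<close> over \<open>R\<close>.
\<close>

definition generator_count :: "nat \<Rightarrow> nat \<Rightarrow> nat" where
  "generator_count d m = (\<Prod>i<m. (q ^ k) ^ (d * m) - (q ^ (k - 1)) ^ (d * m) * (q ^ d) ^ i)"

abbreviation component :: "nat \<Rightarrow> 'a mat \<Rightarrow> 'a poly \<Rightarrow> (nat \<Rightarrow> 'a) set" where
  "component n X Q \<equiv> annihilated (mat_act n X) (vectors n UNIV) Q"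

abbreviation generators :: "nat \<Rightarrow> 'a mat \<Rightarrow> 'a poly \<Rightarrow> nat \<Rightarrow> (nat \<Rightarrow> 'a) list set" where
  "generators n X Q m \<equiv>
    module_endomorphism.generating_lists vec_scale (matrix_map n X) (component n X Q) m"

end

locale factored_polynomial = chain_residue red \<pi> k q
  for red :: "'a::{finite,comm_ring_1} \<Rightarrow> 'f::{finite,field_gcd}" and \<pi> k q +
  fixes J :: "'j set" and Q :: "'j \<Rightarrow> 'a poly"
  assumes finite_J: "finite J"
    and monic_Q: "\<And>j. j \<in> J \<Longrightarrow> lead_coeff (Q j) = 1"
    and irreducible_Q: "\<And>j. j \<in> J \<Longrightarrow> Factorial_Ring.irreducible (red_poly (Q j))"
    and distinct_Q: "inj_on (\<lambda>j. red_poly (Q j)) J"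
begin

lemma comaximal_Q:
  assumes "i \<in> J" "j \<in> J" "i \<noteq> j"
  shows "comaximal (Q i) (Q j)"
  using assms distinct_Q
  by (intro comaximal_lift comaximal_monic_irreducible irreducible_Q degree_red_poly_monic(2) monic_Q)
    (auto dest: inj_onD)

abbreviation dimension :: "('j \<Rightarrow> nat) \<Rightarrow> nat" where
  "dimension \<nu> \<equiv> (\<Sum>j\<in>J. \<nu> j * Polynomial.degree (Q j))"

definition roots :: "nat \<Rightarrow> 'a mat set" where
  "roots n = {X \<in> carrier_mat n n. poly_mat (\<Prod>j\<in>J. Q j) X = 0\<^sub>m n n}"

definition generating_families :: "nat \<Rightarrow> 'a mat \<Rightarrow> ('j \<Rightarrow> nat) \<Rightarrow> ('j \<Rightarrow> (nat \<Rightarrow> 'a) list) set" where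
  "generating_families n X \<nu> = (\<Pi>\<^sub>E j\<in>J. generators n X (Q j) (\<nu> j))"

text \<open>
  The second equation is the primary decomposition of \<open>\<pi> R^n\<close>. Its components are the multiples by
  \<open>\<pi>\<close> of those of \<open>R^n\<close>, because the projections commute with \<open>\<pi>\<close>.
\<close>

lemma
  assumes X: "X \<in> roots n"
  shows prod_card_component: "(\<Prod>j\<in>J. card (component n X (Q j))) = (q ^ k) ^ n"
    and prod_card_pi_component:
      "(\<Prod>j\<in>J. card (vec_scale \<pi> ` component n X (Q j))) = (q ^ (k - 1)) ^ n"
proof -
  interpret chain_endomorphism red \<pi> k q vec_scale "matrix_map n X"
    by (rule chain_endomorphism_matrix)
  let ?V = "vectors n (UNIV :: 'a set)"
  have V: "poly_module.subspace ?V"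
    by (simp add: poly_subspace_iff subspace_vectors matrix_map_in_vectors)
  have ann: "act (\<Prod>j\<in>J. Q j) u = 0" if "u \<in> ?V" for u
    using X that poly_mat_eq_0_iff by (auto simp: roots_def)
  have "card ?V = (\<Prod>j\<in>J. card (component n X (Q j)))"
    using finite_J comaximal_Q V ann by (rule poly_module.card_eq_prod_annihilated)
  then show "(\<Prod>j\<in>J. card (component n X (Q j))) = (q ^ k) ^ n" by (simp add: card_space)
  obtain e where e: "\<And>j u. j \<in> J \<Longrightarrow> u \<in> ?V \<Longrightarrow> act (e j) u \<in> component n X (Q j)"
    "\<And>i j u. i \<in> J \<Longrightarrow> j \<in> J \<Longrightarrow> u \<in> component n X (Q j) \<Longrightarrow> act (e i) u = (if i = j then u else 0)"
    "\<And>u. u \<in> ?V \<Longrightarrow> (\<Sum>j\<in>J. act (e j) u) = u"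
    using poly_module.ex_projections[OF finite_J comaximal_Q V ann] by blast
  have pi: "annihilated act (pi_multiples ?V) (Q j) = pi_multiples (component n X (Q j))"
    if j: "j \<in> J" for j
  proof (intro equalityI subsetI)
    fix w assume w: "w \<in> annihilated act (pi_multiples ?V) (Q j)"
    then obtain u where u: "u \<in> ?V" "w = vec_scale \<pi> u" by (auto simp: annihilated_def)
    have "w \<in> component n X (Q j)"
      using w pi_multiples_subset[OF V] unfolding annihilated_def by blast
    then have "w = act (e j) w" using e(2)[OF j j] by simp
    also have "\<dots> = vec_scale \<pi> (act (e j) u)" using u by (simp add: act_scale_right)
    finally show "w \<in> pi_multiples (component n X (Q j))" using e(1)[OF j u(1)] by blast
  next
    fix w assume "w \<in> pi_multiples (component n X (Q j))"
    then show "w \<in> annihilated act (pi_multiples ?V) (Q j)"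
      by (auto simp: annihilated_def act_scale_right)
  qed
  have "card (pi_multiples ?V) = (\<Prod>j\<in>J. card (annihilated act (pi_multiples ?V) (Q j)))"
  proof (rule poly_module.card_eq_prod_annihilated[OF finite_J])
    show "act (\<Prod>j\<in>J. Q j) u = 0" if "u \<in> pi_multiples ?V" for u
      using that pi_multiples_subset[OF V] by (intro ann) blast
  qed (fact comaximal_Q, fact subspace_pi_multiples[OF V])
  then show "(\<Prod>j\<in>J. card (vec_scale \<pi> ` component n X (Q j))) = (q ^ (k - 1)) ^ n"
    using pi by (simp add: card_pi_multiples_space)
qed

text \<open>
  The exponents \<open>r j\<close> are the ranks of the components. Comparing the product of the sizes of the
  quotients by \<open>\<pi>\<close> with \<open>q ^ n\<close> gives the dimension formula; then the upper bounds for the sizes of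
  the components multiply to the size of \<open>R^n\<close> and must be attained. Generating lists of lengths
  \<open>\<nu> j\<close> need \<open>r j \<le> \<nu> j\<close>, and with equal dimensions this forces \<open>\<nu> = r\<close>.
\<close>

lemma ex_type:
  assumes X: "X \<in> roots n"
  shows "\<exists>r\<in>J \<rightarrow>\<^sub>E UNIV. dimension r = n \<and>
    (\<forall>\<nu>\<in>J \<rightarrow>\<^sub>E UNIV. dimension \<nu> = n \<longrightarrow> card (generating_families n X \<nu>)
      = (if \<nu> = r then \<Prod>j\<in>J. generator_count (Polynomial.degree (Q j)) (\<nu> j) else 0))"
proof -
  interpret chain_endomorphism red \<pi> k q vec_scale "matrix_map n X"
    by (rule chain_endomorphism_matrix)
  let ?U = "\<lambda>j. component n X (Q j)" and ?d = "\<lambda>j. Polynomial.degree (Q j)"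
  have "poly_module.subspace (vectors n UNIV)"
    by (simp add: poly_subspace_iff subspace_vectors matrix_map_in_vectors)
  then have sub: "poly_module.subspace (?U j)" for j by (rule poly_module.subspace_annihilated)
  have fin: "finite (?U j)" for j
    using finite_space by (rule finite_subset[rotated]) (auto simp: annihilated_def)
  have "\<exists>r. card (?U j) = card (pi_multiples (?U j)) * (q ^ ?d j) ^ r
      \<and> card (?U j) \<le> ((q ^ k) ^ ?d j) ^ r
      \<and> (\<forall>s. generating_lists (?U j) s \<noteq> {} \<longrightarrow> r \<le> s)
      \<and> card (generating_lists (?U j) r)
        = (\<Prod>i<r. card (?U j) - card (pi_multiples (?U j)) * (q ^ ?d j) ^ i)"
    if j: "j \<in> J" for j
  proof (rule component_rank[OF sub fin monic_Q[OF j] irreducible_Q[OF j]])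
    show "act (Q j) u = 0" if "u \<in> ?U j" for u using that by (simp add: annihilated_def)
  qed blast
  then obtain r\<^sub>0 where r\<^sub>0: "\<And>j. j \<in> J \<Longrightarrow> card (?U j) = card (pi_multiples (?U j)) * (q ^ ?d j) ^ r\<^sub>0 j"
      "\<And>j. j \<in> J \<Longrightarrow> card (?U j) \<le> ((q ^ k) ^ ?d j) ^ r\<^sub>0 j"
      "\<And>j s. j \<in> J \<Longrightarrow> generating_lists (?U j) s \<noteq> {} \<Longrightarrow> r\<^sub>0 j \<le> s"
      "\<And>j. j \<in> J \<Longrightarrow> card (generating_lists (?U j) (r\<^sub>0 j))
        = (\<Prod>i<r\<^sub>0 j. card (?U j) - card (pi_multiples (?U j)) * (q ^ ?d j) ^ i)"
    by metis
  define r where "r = restrict r\<^sub>0 J"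
  have q0: "q > 0" using q_gt_1 by simp
  have "(q ^ k) ^ n = (\<Prod>j\<in>J. card (pi_multiples (?U j)) * (q ^ ?d j) ^ r\<^sub>0 j)"
    unfolding prod_card_component[OF X, symmetric] using r\<^sub>0(1) by (intro prod.cong) auto
  also have "\<dots> = (q ^ (k - 1)) ^ n * q ^ (\<Sum>j\<in>J. r\<^sub>0 j * ?d j)"
    by (simp add: prod.distrib prod_card_pi_component[OF X] power_sum power_mult[symmetric] mult.commute)
  also have "(q ^ k) ^ n = (q ^ (k - 1)) ^ n * q ^ n"
    using k_pos by (cases k) (simp_all add: power_mult_distrib mult.commute)
  finally have "q ^ n = q ^ (\<Sum>j\<in>J. r\<^sub>0 j * ?d j)" using q0 by simp
  then have "n = (\<Sum>j\<in>J. r\<^sub>0 j * ?d j)" using q_gt_1 by (simp add: power_inject_exp)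
  then have dim: "dimension r = n" by (simp add: r_def)
  have card_U: "card (?U j) = (q ^ k) ^ (?d j * r j)" if j: "j \<in> J" for j
  proof (rule prod_le_eq_imp_eq[OF finite_J _ _ _ j])
    have "(\<Prod>j\<in>J. (q ^ k) ^ (?d j * r j)) = (q ^ k) ^ n"
      by (simp add: dim[symmetric] power_sum mult.commute)
    then show "(\<Prod>j\<in>J. card (?U j)) = (\<Prod>j\<in>J. (q ^ k) ^ (?d j * r j))"
      by (simp add: prod_card_component[OF X])
  qed (use r\<^sub>0(2) q0 in \<open>auto simp: r_def power_mult\<close>)
  have card_pi_U: "card (pi_multiples (?U j)) = (q ^ (k - 1)) ^ (?d j * r j)" if j: "j \<in> J" for j
  proof -
    have "(q ^ k) ^ (?d j * r j) = card (pi_multiples (?U j)) * q ^ (?d j * r j)"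
      using r\<^sub>0(1)[OF j] card_U[OF j] j by (simp add: r_def power_mult)
    moreover have "(q ^ k) ^ (?d j * r j) = (q ^ (k - 1)) ^ (?d j * r j) * q ^ (?d j * r j)"
      using k_pos by (cases k) (simp_all add: power_mult_distrib mult.commute)
    ultimately show ?thesis using q0 by simp
  qed
  have count: "card (generating_lists (?U j) (r j)) = generator_count (?d j) (r j)" if j: "j \<in> J" for j
    using r\<^sub>0(4)[OF j] card_U[OF j] card_pi_U[OF j] j by (simp add: r_def generator_count_def)
  have "card (generating_families n X \<nu>)
      = (if \<nu> = r then \<Prod>j\<in>J. generator_count (?d j) (\<nu> j) else 0)"
    if \<nu>: "\<nu> \<in> J \<rightarrow>\<^sub>E UNIV" "dimension \<nu> = n" for \<nu>
  proof (cases "\<nu> = r")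
    case True
    then show ?thesis
      using count by (simp add: generating_families_def card_PiE finite_J cong: prod.cong)
  next
    case False
    have "generating_families n X \<nu> = {}"
    proof (rule ccontr)
      assume "generating_families n X \<nu> \<noteq> {}"
      then have "generating_lists (?U j) (\<nu> j) \<noteq> {}" if "j \<in> J" for j
        using that by (auto simp: generating_families_def PiE_eq_empty_iff)
      then have "r j \<le> \<nu> j" if "j \<in> J" for j using r\<^sub>0(3) that by (simp add: r_def)
      moreover have "?d j > 0" if "j \<in> J" for j
        using degree_irreducible_pos monic_Q irreducible_Q that by blast
      ultimately have "r j = \<nu> j" if "j \<in> J" for j
        using sum_le_eq_imp_eq[of J r \<nu> ?d j] finite_J dim \<nu>(2) that by simp
      then have "\<nu> x = r x" for x
        using PiE_arb[OF \<nu>(1), of x] by (cases "x \<in> J") (simp_all add: r_def)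
      then show False using False by auto
    qed
    then show ?thesis using False by simp
  qed
  moreover have "r \<in> J \<rightarrow>\<^sub>E UNIV" by (simp add: r_def)
  ultimately show ?thesis using dim by blast
qed

end

section \<open>Bases adapted to a root\<close>

lemma matrix_map_zero: "matrix_map n (0\<^sub>m n n) f = 0"
  by (simp add: matrix_map_def fun_eq_iff)

context chain_residue
begin

text \<open>
  For the zero matrix all polynomials act by their constant coefficients. So \<open>R^n\<close> is its component for
  the polynomial \<open>t\<close>, and the generating lists are those over \<open>R\<close>.
\<close>

lemma card_spanning_lists:
  "card {xs :: (nat \<Rightarrow> 'a) list. length xs = n \<and> set xs \<subseteq> vectors n UNIV \<and> coord.span (set xs) = vectors n UNIV}
    = generator_count 1 n"
proof -
  let ?V = "vectors n (UNIV :: 'a set)"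
  interpret chain_endomorphism red \<pi> k q vec_scale "matrix_map n (0\<^sub>m n n)"
    by (rule chain_endomorphism_matrix)
  have V: "poly_module.subspace ?V"
    by (simp add: poly_subspace_iff subspace_vectors matrix_map_in_vectors)
  have span: "poly_module.span S = coord.span S" for S
  proof (rule antisym)
    have "poly_module.subspace (coord.span S)"
      by (simp add: poly_subspace_iff matrix_map_zero coord.span_zero)
    then show "poly_module.span S \<subseteq> coord.span S"
      using coord.span_superset by (intro poly_module.span_minimal)
    have "coord.subspace (poly_module.span S)"
      using poly_module.subspace_span[of S] by (simp only: poly_subspace_iff)
    then show "coord.span S \<subseteq> poly_module.span S"
      using poly_module.span_superset by (intro coord.span_minimal)
  qed
  have Q: "lead_coeff [:0, 1:: 'a:] = 1" by simp
  have irr: "Factorial_Ring.irreducible (red_poly [:0, 1:])"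
    by (simp add: red.map_poly_pCons_hom irreducible_linear_field_poly)
  have ann: "act [:0, 1:] u = 0" if "u \<in> ?V" for u
    by (simp add: matrix_map_zero)
  have "\<exists>r. card ?V = card (pi_multiples ?V) * (q ^ Polynomial.degree [:0, 1 :: 'a:]) ^ r
    \<and> card (generating_lists ?V r)
      = (\<Prod>i<r. card ?V - card (pi_multiples ?V) * (q ^ Polynomial.degree [:0, 1 :: 'a:]) ^ i)"
    by (rule component_rank[OF V finite_space Q irr ann]) (assumption, blast)
  then obtain r where "card ?V = card (pi_multiples ?V) * (q ^ Polynomial.degree [:0, 1 :: 'a:]) ^ r
    \<and> card (generating_lists ?V r)
      = (\<Prod>i<r. card ?V - card (pi_multiples ?V) * (q ^ Polynomial.degree [:0, 1 :: 'a:]) ^ i)"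
    by (rule exE)
  then have r: "card ?V = card (pi_multiples ?V) * (q ^ Polynomial.degree [:0, 1 :: 'a:]) ^ r"
    "card (generating_lists ?V r)
      = (\<Prod>i<r. card ?V - card (pi_multiples ?V) * (q ^ Polynomial.degree [:0, 1 :: 'a:]) ^ i)"
    by simp_all
  have "(q ^ (k - 1)) ^ n * q ^ r = (q ^ k) ^ n"
    using r(1) by (simp add: card_space card_pi_multiples_space)
  also have "(q ^ k) ^ n = (q ^ (k - 1)) ^ n * q ^ n"
    using k_pos by (cases k) (simp_all add: power_mult_distrib mult.commute)
  finally have "r = n" using q_gt_1 by (simp add: power_inject_exp)
  then show ?thesis
    using r(2) by (simp add: generating_lists_def span generator_count_def card_space card_pi_multiples_space)
qed

lemma generator_count_eq:
  assumes d: "d > 0"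
  shows "real (generator_count d m) = real q ^ (k * d * m\<^sup>2) * (\<Prod>i=1..m. 1 - 1 / real q ^ (i * d))"
proof -
  let ?N = "k * (d * m)"
  have q0: "real q > 0" using q_gt_1 by simp
  have factor: "real ((q ^ k) ^ (d * m) - (q ^ (k - 1)) ^ (d * m) * (q ^ d) ^ i)
      = real q ^ ?N * (1 - 1 / real q ^ (Suc (m - Suc i) * d))" if i: "i < m" for i
  proof -
    have split: "?N = ((k - 1) * (d * m) + d * i) + Suc (m - Suc i) * d"
    proof -
      have 1: "?N = (k - 1) * (d * m) + d * m" using k_pos by (cases k) simp_all
      have "d * m = d * (i + Suc (m - Suc i))" using i by simp
      then have 2: "d * m = d * i + Suc (m - Suc i) * d"
        by (simp only: add_mult_distrib2 mult.commute)
      show ?thesis using 1 2 by linarith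
    qed
    have B: "(q ^ (k - 1)) ^ (d * m) * (q ^ d) ^ i = q ^ ((k - 1) * (d * m) + d * i)"
      by (simp only: power_mult power_add)
    have "q ^ ((k - 1) * (d * m) + d * i) \<le> q ^ ?N"
      using q_gt_1 by (intro power_increasing) (subst split, simp_all)
    then have "real (q ^ ?N - q ^ ((k - 1) * (d * m) + d * i))
        = real q ^ ?N - real q ^ ((k - 1) * (d * m) + d * i)"
      by (simp add: of_nat_diff)
    also have "real q ^ ((k - 1) * (d * m) + d * i) = real q ^ ?N / real q ^ (Suc (m - Suc i) * d)"
      using q0 unfolding split power_add by simp
    finally have *: "real (q ^ ?N - q ^ ((k - 1) * (d * m) + d * i))
        = real q ^ ?N - real q ^ ?N / real q ^ (Suc (m - Suc i) * d)" .
    show ?thesis unfolding B unfolding power_mult[symmetric] * by (simp add: right_diff_distrib)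
  qed
  have "real (generator_count d m) = (\<Prod>i<m. real q ^ ?N * (1 - 1 / real q ^ (Suc (m - Suc i) * d)))"
    unfolding generator_count_def of_nat_prod using factor by (intro prod.cong) auto
  also have "\<dots> = real q ^ (?N * m) * (\<Prod>i<m. 1 - 1 / real q ^ (Suc (m - Suc i) * d))"
    by (simp only: prod.distrib prod_constant card_lessThan power_mult)
  also have "(\<Prod>i<m. 1 - 1 / real q ^ (Suc (m - Suc i) * d)) = (\<Prod>i<m. 1 - 1 / real q ^ (Suc i * d))"
    by (rule prod.nat_diff_reindex)
  also have "\<dots> = (\<Prod>i=1..m. 1 - 1 / real q ^ (i * d))"
    by (simp add: prod.atLeast1_atMost_eq)
  also have "?N * m = k * d * m\<^sup>2" by (simp add: power2_eq_square)
  finally show ?thesis .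
qed

lemma generator_count_pos:
  assumes d: "d > 0"
  shows "generator_count d m > 0"
proof -
  have "1 - 1 / real q ^ (i * d) > 0" if "i \<in> {1..m}" for i
    using that d q_gt_1 one_less_power[of "real q" "i * d"] by simp
  then have "(\<Prod>i=1..m. 1 - 1 / real q ^ (i * d)) > 0" by (rule prod_pos)
  then have "real (generator_count d m) > 0" unfolding generator_count_eq[OF d] using q_gt_1 by simp
  then show ?thesis by simp
qed

end

context factored_polynomial
begin

text \<open>
  The triple \<open>(j, i, a)\<close> is the position of \<open>X ^ a\<close> applied to the \<open>i\<close>-th generator of the \<open>j\<close>-th
  component.
\<close>

definition basis_index :: "('j \<Rightarrow> nat) \<Rightarrow> ('j \<times> nat \<times> nat) set" where
  "basis_index \<nu> = (SIGMA j:J. {..<\<nu> j} \<times> {..<Polynomial.degree (Q j)})"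

definition spanning_families :: "nat \<Rightarrow> ('j \<Rightarrow> nat) \<Rightarrow> ('j \<times> nat \<times> nat \<Rightarrow> nat \<Rightarrow> 'a) set" where
  "spanning_families n \<nu> = {b \<in> basis_index \<nu> \<rightarrow>\<^sub>E vectors n UNIV.
     coord.span (b ` basis_index \<nu>) = vectors n UNIV}"

lemma
  shows finite_basis_index: "finite (basis_index \<nu>)"
    and card_basis_index: "card (basis_index \<nu>) = dimension \<nu>"
proof -
  have fin: "\<forall>j\<in>J. finite ({..<\<nu> j} \<times> {..<Polynomial.degree (Q j)})" by simp
  then show "finite (basis_index \<nu>)" unfolding basis_index_def using fin by (intro finite_SigmaI[OF finite_J]) blast
  show "card (basis_index \<nu>) = dimension \<nu>"
    unfolding basis_index_def card_SigmaI[OF finite_J fin] card_cartesian_product card_lessThan ..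
qed

lemma card_spanning_families:
  assumes "dimension \<nu> = n"
  shows "card (spanning_families n \<nu>) = generator_count 1 n"
proof -
  let ?D = "basis_index \<nu>" and ?V = "vectors n (UNIV :: 'a set)"
  obtain h where h: "bij_betw h {..<n} ?D"
    using finite_basis_index card_basis_index[of \<nu>] assms
    by (metis ex_bij_betw_nat_finite lessThan_atLeast0)
  let ?h' = "inv_into {..<n} h"
  have h': "?h' d < n" "h (?h' d) = d" if "d \<in> ?D" for d
    using bij_betw_imp_surj_on[OF h] that inv_into_into[of d h "{..<n}"] f_inv_into_f[of d h "{..<n}"]
    by auto
  have hh: "h i \<in> ?D" "?h' (h i) = i" if "i < n" for i
    using h that by (auto simp: bij_betw_def inv_into_f_f)
  let ?L = "{xs. length xs = n \<and> set xs \<subseteq> ?V \<and> coord.span (set xs) = ?V}"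
  have "bij_betw (\<lambda>b. map (\<lambda>i. b (h i)) [0..<n]) (spanning_families n \<nu>) ?L"
  proof (rule bij_betw_byWitness[of _ "\<lambda>xs. \<lambda>d\<in>?D. xs ! ?h' d"])
    show "\<forall>b\<in>spanning_families n \<nu>. (\<lambda>d\<in>?D. map (\<lambda>i. b (h i)) [0..<n] ! ?h' d) = b"
    proof
      fix b assume "b \<in> spanning_families n \<nu>"
      then have b: "b \<in> ?D \<rightarrow>\<^sub>E ?V" by (simp add: spanning_families_def)
      show "(\<lambda>d\<in>?D. map (\<lambda>i. b (h i)) [0..<n] ! ?h' d) = b"
      proof
        fix d show "(\<lambda>d\<in>?D. map (\<lambda>i. b (h i)) [0..<n] ! ?h' d) d = b d"
          using h' PiE_arb[OF b, of d] by (cases "d \<in> ?D") simp_all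
      qed
    qed
    show "\<forall>xs\<in>?L. map (\<lambda>i. (\<lambda>d\<in>?D. xs ! ?h' d) (h i)) [0..<n] = xs"
      using hh by (auto intro!: nth_equalityI)
    show "(\<lambda>b. map (\<lambda>i. b (h i)) [0..<n]) ` spanning_families n \<nu> \<subseteq> ?L"
    proof (rule image_subsetI)
      fix b assume b: "b \<in> spanning_families n \<nu>"
      have "set (map (\<lambda>i. b (h i)) [0..<n]) = b ` (h ` {..<n})"
        by (simp add: image_image lessThan_atLeast0)
      then have "set (map (\<lambda>i. b (h i)) [0..<n]) = b ` ?D"
        by (simp only: bij_betw_imp_surj_on[OF h])
      moreover have "b ` ?D \<subseteq> ?V" "coord.span (b ` ?D) = ?V"
        using b by (auto simp: spanning_families_def)
      ultimately show "map (\<lambda>i. b (h i)) [0..<n] \<in> ?L" by simp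
    qed
    show "(\<lambda>xs. \<lambda>d\<in>?D. xs ! ?h' d) ` ?L \<subseteq> spanning_families n \<nu>"
    proof (rule image_subsetI)
      fix xs assume xs: "xs \<in> ?L"
      have "(\<lambda>d\<in>?D. xs ! ?h' d) ` ?D = (\<lambda>d. xs ! ?h' d) ` (h ` {..<n})"
        by (simp add: bij_betw_imp_surj_on[OF h])
      also have "\<dots> = (\<lambda>i. xs ! i) ` {..<n}" using hh by (simp add: image_image)
      also have "\<dots> = set xs" using xs by (auto simp: set_conv_nth)
      finally have img: "(\<lambda>d\<in>?D. xs ! ?h' d) ` ?D = set xs" .
      have "(\<lambda>d\<in>?D. xs ! ?h' d) \<in> ?D \<rightarrow>\<^sub>E ?V"
        using xs h' by (auto simp: PiE_iff subset_iff)
      then show "(\<lambda>d\<in>?D. xs ! ?h' d) \<in> spanning_families n \<nu>"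
        unfolding spanning_families_def mem_Collect_eq img using xs by simp
    qed
  qed
  from bij_betw_same_card[OF this] show ?thesis by (simp only: card_spanning_lists)
qed

text \<open>
  The action of the companion matrix of \<open>Q j\<close>: the vectors \<open>b (j, i, a)\<close> behave like the powers of \<open>t\<close> in
  \<open>R[t] / (Q j)\<close>.
\<close>

definition next_basis :: "('j \<times> nat \<times> nat \<Rightarrow> nat \<Rightarrow> 'a) \<Rightarrow> 'j \<times> nat \<times> nat \<Rightarrow> nat \<Rightarrow> 'a" where
  "next_basis b = (\<lambda>(j, i, a). if Suc a < Polynomial.degree (Q j) then b (j, i, Suc a)
     else - (\<Sum>m<Polynomial.degree (Q j). vec_scale (Polynomial.coeff (Q j) m) (b (j, i, m))))"

definition orbit_family ::
  "nat \<Rightarrow> ('j \<Rightarrow> nat) \<Rightarrow> 'a mat \<times> ('j \<Rightarrow> (nat \<Rightarrow> 'a) list) \<Rightarrow> 'j \<times> nat \<times> nat \<Rightarrow> nat \<Rightarrow> 'a" where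
  "orbit_family n \<nu> = (\<lambda>(X, v). \<lambda>(j, i, a)\<in>basis_index \<nu>. (matrix_map n X ^^ a) (v j ! i))"

lemma degree_Q_pos: "j \<in> J \<Longrightarrow> Polynomial.degree (Q j) > 0"
  by (rule degree_irreducible_pos[OF monic_Q irreducible_Q])

lemma mat_act_Q_eq:
  assumes "j \<in> J"
  shows "mat_act n X (Q j) u = (matrix_map n X ^^ Polynomial.degree (Q j)) u
    + (\<Sum>m<Polynomial.degree (Q j). vec_scale (Polynomial.coeff (Q j) m) ((matrix_map n X ^^ m) u))"
proof -
  interpret module_endomorphism vec_scale "matrix_map n X" by (rule module_endomorphism_matrix_map)
  let ?d = "Polynomial.degree (Q j)"
  have "mat_act n X (Q j) u
      = (\<Sum>m<Suc ?d. vec_scale (Polynomial.coeff (Q j) m) ((matrix_map n X ^^ m) u))"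
    by (simp only: act_eq_sum lessThan_Suc_atMost)
  also have "\<dots> = (\<Sum>m<?d. vec_scale (Polynomial.coeff (Q j) m) ((matrix_map n X ^^ m) u))
      + vec_scale (Polynomial.coeff (Q j) ?d) ((matrix_map n X ^^ ?d) u)"
    by (rule sum.lessThan_Suc)
  also have "vec_scale (Polynomial.coeff (Q j) ?d) ((matrix_map n X ^^ ?d) u) = (matrix_map n X ^^ ?d) u"
    using monic_Q[OF assms] by simp
  finally show ?thesis by (rule trans[OF _ add.commute])
qed

lemma matrix_map_orbit_family:
  assumes v: "v \<in> generating_families n X \<nu>" and d: "d \<in> basis_index \<nu>"
  shows "matrix_map n X (orbit_family n \<nu> (X, v) d) = next_basis (orbit_family n \<nu> (X, v)) d"
proof -
  interpret module_endomorphism vec_scale "matrix_map n X" by (rule module_endomorphism_matrix_map)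
  obtain j i a where d_eq: "d = (j, i, a)" by (cases d)
  then have j: "j \<in> J" and i: "i < \<nu> j" and a: "a < Polynomial.degree (Q j)"
    using d by (auto simp: basis_index_def)
  have idx: "(j, i, m) \<in> basis_index \<nu>" if "m < Polynomial.degree (Q j)" for m
    using i j that by (simp add: basis_index_def)
  have "v j \<in> generators n X (Q j) (\<nu> j)" using v j by (auto simp: generating_families_def)
  then have "v j ! i \<in> component n X (Q j)" using i by (auto simp: generating_lists_def)
  then have Q0: "mat_act n X (Q j) (v j ! i) = 0" by (simp add: annihilated_def)
  show ?thesis
  proof (cases "Suc a < Polynomial.degree (Q j)")
    case True
    then show ?thesis using a idx by (simp add: d_eq orbit_family_def next_basis_def)
  next
    case False
    then have "Suc a = Polynomial.degree (Q j)" using a by simp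
    then have "matrix_map n X (orbit_family n \<nu> (X, v) d)
        = (matrix_map n X ^^ Polynomial.degree (Q j)) (v j ! i)"
      using idx[OF a] by (simp add: d_eq orbit_family_def flip: funpow.simps(2) o_apply[of _ "_ ^^ a"])
    also have "\<dots> = - (\<Sum>m<Polynomial.degree (Q j).
        vec_scale (Polynomial.coeff (Q j) m) ((matrix_map n X ^^ m) (v j ! i)))"
      using Q0 unfolding mat_act_Q_eq[OF j] by (simp add: eq_neg_iff_add_eq_0)
    also have "\<dots> = next_basis (orbit_family n \<nu> (X, v)) d"
      using False idx by (simp add: d_eq orbit_family_def next_basis_def)
    finally show ?thesis .
  qed
qed

lemma span_components:
  assumes X: "X \<in> roots n"
    and W: "Modules.module.subspace (mat_act n X) W"
    and sub: "\<And>j. j \<in> J \<Longrightarrow> component n X (Q j) \<subseteq> W"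
  shows "vectors n UNIV \<subseteq> W"
proof
  interpret chain_endomorphism red \<pi> k q vec_scale "matrix_map n X"
    by (rule chain_endomorphism_matrix)
  let ?V = "vectors n (UNIV :: 'a set)"
  have V: "poly_module.subspace ?V"
    by (simp add: poly_subspace_iff subspace_vectors matrix_map_in_vectors)
  have ann: "act (\<Prod>j\<in>J. Q j) u = 0" if "u \<in> ?V" for u
    using X that poly_mat_eq_0_iff by (auto simp: roots_def)
  obtain e where e: "\<And>j u. j \<in> J \<Longrightarrow> u \<in> ?V \<Longrightarrow> act (e j) u \<in> component n X (Q j)"
    "\<And>i j u. i \<in> J \<Longrightarrow> j \<in> J \<Longrightarrow> u \<in> component n X (Q j) \<Longrightarrow> act (e i) u = (if i = j then u else 0)"
    "\<And>u. u \<in> ?V \<Longrightarrow> (\<Sum>j\<in>J. act (e j) u) = u"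
    using poly_module.ex_projections[OF finite_J comaximal_Q V ann] by blast
  fix u assume u: "u \<in> ?V"
  have "(\<Sum>j\<in>J. act (e j) u) \<in> W" using e(1)[OF _ u] sub by (intro poly_module.subspace_sum[OF W]) blast
  then show "u \<in> W" using e(3)[OF u] by simp
qed

text \<open>
  The projection to the \<open>i\<close>-th component fixes the vectors of \<open>S i\<close> and kills the other \<open>S j\<close>, so it
  turns an expression in all generators into one in those of \<open>S i\<close>.
\<close>

lemma span_component_of_generators:
  assumes X: "X \<in> roots n" and S: "\<And>j. j \<in> J \<Longrightarrow> S j \<subseteq> component n X (Q j)"
    and gen: "vectors n UNIV \<subseteq> Modules.module.span (mat_act n X) (\<Union>j\<in>J. S j)" and i: "i \<in> J"
  shows "Modules.module.span (mat_act n X) (S i) = component n X (Q i)"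
proof (rule antisym)
  interpret chain_endomorphism red \<pi> k q vec_scale "matrix_map n X"
    by (rule chain_endomorphism_matrix)
  let ?V = "vectors n (UNIV :: 'a set)"
  have V: "poly_module.subspace ?V"
    by (simp add: poly_subspace_iff subspace_vectors matrix_map_in_vectors)
  have ann: "act (\<Prod>j\<in>J. Q j) u = 0" if "u \<in> ?V" for u
    using X that poly_mat_eq_0_iff by (auto simp: roots_def)
  obtain e where e: "\<And>j u. j \<in> J \<Longrightarrow> u \<in> ?V \<Longrightarrow> act (e j) u \<in> component n X (Q j)"
    "\<And>i j u. i \<in> J \<Longrightarrow> j \<in> J \<Longrightarrow> u \<in> component n X (Q j) \<Longrightarrow> act (e i) u = (if i = j then u else 0)"
    "\<And>u. u \<in> ?V \<Longrightarrow> (\<Sum>j\<in>J. act (e j) u) = u"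
    using poly_module.ex_projections[OF finite_J comaximal_Q V ann] by blast
  show "poly_module.span (S i) \<subseteq> component n X (Q i)"
    using S[OF i] poly_module.subspace_annihilated[OF V] by (rule poly_module.span_minimal)
  let ?W = "{w. act (e i) w \<in> poly_module.span (S i)}"
  have "poly_module.subspace ?W"
  proof (rule poly_module.subspaceI)
    show "act c x \<in> ?W" if "x \<in> ?W" for c x
    proof -
      have "act (e i) (act c x) = act c (act (e i) x)" by (rule poly_module.scale_left_commute)
      then show ?thesis using that poly_module.span_scale[of "act (e i) x" "S i" c] by simp
    qed
  qed (simp_all add: poly_module.span_zero poly_module.scale_right_distrib poly_module.span_add)
  moreover have "S j \<subseteq> ?W" if j: "j \<in> J" for j
  proof
    fix w assume w: "w \<in> S j"
    then have "act (e i) w = (if i = j then w else 0)" using S[OF j] e(2)[OF i j] by blast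
    then show "w \<in> ?W" using w by (simp add: poly_module.span_base poly_module.span_zero)
  qed
  ultimately have "poly_module.span (\<Union>j\<in>J. S j) \<subseteq> ?W"
    by (intro poly_module.span_minimal) auto
  then have W: "?V \<subseteq> ?W" using gen by blast
  show "component n X (Q i) \<subseteq> poly_module.span (S i)"
  proof
    fix u assume u: "u \<in> component n X (Q i)"
    then have "u \<in> ?W" using W by (auto simp: annihilated_def)
    then show "u \<in> poly_module.span (S i)" using e(2)[OF i i u] by simp
  qed
qed

text \<open>
  The span over \<open>R\<close> of the orbit family is stable under \<open>X\<close>, by the companion relation, and contains
  the generators of all components. So it contains the components and with them \<open>R^n\<close>.
\<close>

lemma orbit_family_in_spanning_families:
  assumes X: "X \<in> roots n" and v: "v \<in> generating_families n X \<nu>"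
  shows "orbit_family n \<nu> (X, v) \<in> spanning_families n \<nu>"
proof -
  interpret chain_endomorphism red \<pi> k q vec_scale "matrix_map n X"
    by (rule chain_endomorphism_matrix)
  let ?V = "vectors n (UNIV :: 'a set)" and ?b = "orbit_family n \<nu> (X, v)" and ?D = "basis_index \<nu>"
  have V: "poly_module.subspace ?V"
    by (simp add: poly_subspace_iff subspace_vectors matrix_map_in_vectors)
  have vj: "length (v j) = \<nu> j" "set (v j) \<subseteq> component n X (Q j)"
      "poly_module.span (set (v j)) = component n X (Q j)" if "j \<in> J" for j
    using v that by (auto simp: generating_families_def generating_lists_def PiE_iff)
  have iter: "(matrix_map n X ^^ a) w \<in> ?V" if "w \<in> ?V" for a w
    using that by (cases a) (simp_all add: matrix_map_in_vectors)
  have mem: "?b \<in> ?D \<rightarrow>\<^sub>E ?V"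
  proof (rule PiE_I)
    fix d assume d: "d \<in> ?D"
    obtain j i a where d_eq: "d = (j, i, a)" by (cases d)
    then have "v j ! i \<in> set (v j)" "j \<in> J" using d vj(1) by (auto simp: basis_index_def)
    then have "v j ! i \<in> ?V" using vj(2) by (auto simp: annihilated_def)
    then show "?b d \<in> ?V" using d iter by (simp add: d_eq orbit_family_def)
  qed (simp add: orbit_family_def)
  let ?W = "coord.span (?b ` ?D)"
  have bW: "?b d \<in> ?W" if "d \<in> ?D" for d using that by (intro coord.span_base) auto
  have "matrix_map n X w \<in> ?W" if "w \<in> ?W" for w
  proof -
    have "coord.subspace {w. matrix_map n X w \<in> ?W}"
      by (simp add: coord.subspace_def T_add T_scale coord.span_zero coord.span_add coord.span_scale)
    moreover have "matrix_map n X (?b d) \<in> ?W" if d: "d \<in> ?D" for d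
    proof -
      obtain j i a where d_eq: "d = (j, i, a)" by (cases d)
      have "(j, i, m) \<in> ?D" if "m < Polynomial.degree (Q j)" for m
        using d that by (auto simp: d_eq basis_index_def)
      then have "next_basis ?b d \<in> ?W"
        by (auto simp: d_eq next_basis_def intro!: bW coord.span_neg coord.span_sum coord.span_scale)
      then show ?thesis by (simp add: matrix_map_orbit_family[OF v d])
    qed
    ultimately have "?W \<subseteq> {w. matrix_map n X w \<in> ?W}" by (intro coord.span_minimal) auto
    then show ?thesis using that by auto
  qed
  then have W: "poly_module.subspace ?W" by (simp add: poly_subspace_iff)
  have "component n X (Q j) \<subseteq> ?W" if j: "j \<in> J" for j
  proof -
    have "set (v j) \<subseteq> ?W"
    proof
      fix w assume "w \<in> set (v j)"
      then obtain i where i: "i < \<nu> j" "w = v j ! i" using vj(1)[OF j] by (auto simp: in_set_conv_nth)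
      then have "(j, i, 0) \<in> ?D" using j degree_Q_pos by (simp add: basis_index_def)
      then show "w \<in> ?W" using bW[of "(j, i, 0)"] i by (simp add: orbit_family_def)
    qed
    then show ?thesis using poly_module.span_minimal[OF _ W] vj(3)[OF j] by metis
  qed
  then have "?V \<subseteq> ?W" by (rule span_components[OF X W])
  moreover have "?W \<subseteq> ?V" using mem by (intro coord.span_minimal subspace_vectors) auto
  ultimately show ?thesis using mem by (simp add: spanning_families_def)
qed

lemma inj_on_orbit_family:
  "inj_on (orbit_family n \<nu>) (SIGMA X:roots n. generating_families n X \<nu>)"
proof (rule inj_onI)
  fix x y assume x: "x \<in> (SIGMA X:roots n. generating_families n X \<nu>)"
    and y: "y \<in> (SIGMA X:roots n. generating_families n X \<nu>)"
    and eq: "orbit_family n \<nu> x = orbit_family n \<nu> y"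
  obtain X v Y w where xy: "x = (X, v)" "y = (Y, w)" by (cases x, cases y)
  have X: "X \<in> roots n" "v \<in> generating_families n X \<nu>" and Y: "Y \<in> roots n" "w \<in> generating_families n Y \<nu>"
    using x y by (auto simp: xy)
  let ?b = "orbit_family n \<nu> (X, v)"
  have eq': "orbit_family n \<nu> (Y, w) = ?b" using eq xy by simp
  have "coord.span (?b ` basis_index \<nu>) = vectors n UNIV"
    using orbit_family_in_spanning_families[OF X] by (simp add: spanning_families_def)
  then have "X = Y"
  proof (rule matrix_map_eq_on_span)
    fix f assume "f \<in> ?b ` basis_index \<nu>"
    then obtain d where d: "d \<in> basis_index \<nu>" "f = ?b d" by auto
    show "matrix_map n X f = matrix_map n Y f"
      using matrix_map_orbit_family[OF X(2) d(1)] matrix_map_orbit_family[OF Y(2) d(1)] d(2)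
      by (simp add: eq')
  qed (use X Y in \<open>auto simp: roots_def\<close>)
  moreover have "v = w"
  proof
    fix j
    have vw: "v \<in> (\<Pi>\<^sub>E j\<in>J. generators n X (Q j) (\<nu> j))" "w \<in> (\<Pi>\<^sub>E j\<in>J. generators n Y (Q j) (\<nu> j))"
      using X Y by (auto simp: generating_families_def)
    show "v j = w j"
    proof (cases "j \<in> J")
      case True
      have len: "length (v j) = \<nu> j" "length (w j) = \<nu> j"
        using vw True
        by (auto simp: PiE_iff module_endomorphism.generating_lists_def[OF module_endomorphism_matrix_map])
      show ?thesis
      proof (rule nth_equalityI)
        fix i assume "i < length (v j)"
        then have "(j, i, 0) \<in> basis_index \<nu>" using len True degree_Q_pos by (simp add: basis_index_def)
        then show "v j ! i = w j ! i"
          using fun_cong[OF eq', of "(j, i, 0)"] by (simp add: orbit_family_def)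
      qed (simp add: len)
    next
      case False
      then show ?thesis using PiE_arb[OF vw(1)] PiE_arb[OF vw(2)] by simp
    qed
  qed
  ultimately show "x = y" by (simp add: xy)
qed

text \<open>
  The matrix \<open>X\<close> is defined on the basis by the companion relation. Then \<open>Q j\<close> kills \<open>b (j, i, 0)\<close>, and
  so does \<open>P\<close>; since the basis consists of images of these vectors under powers of \<open>X\<close>, it follows
  that \<open>P\<close> kills everything.
\<close>

lemma spanning_family_is_orbit_family:
  assumes b: "b \<in> spanning_families n \<nu>" and dim: "dimension \<nu> = n"
  shows "\<exists>X v. X \<in> roots n \<and> v \<in> generating_families n X \<nu> \<and> orbit_family n \<nu> (X, v) = b"
proof -
  let ?V = "vectors n (UNIV :: 'a set)" and ?D = "basis_index \<nu>"
  have bE: "b \<in> ?D \<rightarrow>\<^sub>E ?V" and gen: "coord.span (b ` ?D) = ?V" using b by (auto simp: spanning_families_def)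
  have idx: "(j, i, m) \<in> ?D \<longleftrightarrow> j \<in> J \<and> i < \<nu> j \<and> m < Polynomial.degree (Q j)" for j i m
    by (auto simp: basis_index_def)
  have bV: "b d \<in> ?V" if "d \<in> ?D" for d using bE that by auto
  have "next_basis b d \<in> ?V" if d: "d \<in> ?D" for d
  proof -
    obtain j i a where d_eq: "d = (j, i, a)" by (cases d)
    have "b (j, i, m) \<in> ?V" if "m < Polynomial.degree (Q j)" for m
      using d that by (intro bV) (simp add: d_eq idx)
    then show ?thesis
      by (auto simp: d_eq next_basis_def intro!: subspace_vectors coord.subspace_neg coord.subspace_sum coord.subspace_scale)
  qed
  then obtain X where X: "X \<in> carrier_mat n n" "\<And>d. d \<in> ?D \<Longrightarrow> matrix_map n X (b d) = next_basis b d"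
    using ex_matrix_map[OF finite_basis_index _ gen] card_basis_index dim by metis
  interpret chain_endomorphism red \<pi> k q vec_scale "matrix_map n X"
    by (rule chain_endomorphism_matrix)
  have iter: "(matrix_map n X ^^ a) (b (j, i, 0)) = b (j, i, a)" if "(j, i, a) \<in> ?D" for j i a
    using that
  proof (induction a)
    case (Suc a)
    then have "(j, i, a) \<in> ?D" by (simp add: idx)
    then show ?case using Suc X(2)[of "(j, i, a)"] by (simp add: next_basis_def idx)
  qed simp
  have kill: "act (Q j) (b (j, i, 0)) = 0" if ji: "j \<in> J" "i < \<nu> j" for j i
  proof -
    let ?d = "Polynomial.degree (Q j)"
    obtain a where a: "?d = Suc a" using degree_Q_pos[OF ji(1)] by (cases ?d) auto
    have "(matrix_map n X ^^ ?d) (b (j, i, 0)) = next_basis b (j, i, a)"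
      using X(2)[of "(j, i, a)"] iter[of j i a] ji by (simp add: a idx)
    also have "\<dots> = - (\<Sum>m<?d. vec_scale (Polynomial.coeff (Q j) m) ((matrix_map n X ^^ m) (b (j, i, 0))))"
    proof -
      have "(\<Sum>m<?d. vec_scale (Polynomial.coeff (Q j) m) (b (j, i, m)))
          = (\<Sum>m<?d. vec_scale (Polynomial.coeff (Q j) m) ((matrix_map n X ^^ m) (b (j, i, 0))))"
        using ji by (intro sum.cong refl) (simp add: iter idx)
      then show ?thesis by (simp add: next_basis_def a)
    qed
    finally show ?thesis by (simp add: mat_act_Q_eq[OF ji(1)])
  qed
  define P where "P = (\<Prod>j\<in>J. Q j)"
  have "?V \<subseteq> annihilated act UNIV P"
  proof -
    have sub: "poly_module.subspace (annihilated act UNIV P)"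
      by (rule poly_module.subspace_annihilated[OF poly_module.subspace_UNIV])
    have "b d \<in> annihilated act UNIV P" if d: "d \<in> ?D" for d
    proof -
      obtain j i a where d_eq: "d = (j, i, a)" by (cases d)
      then have ji: "j \<in> J" "i < \<nu> j" using d idx by auto
      have "Q j dvd P" unfolding P_def using finite_J ji(1) by (rule dvd_prodI)
      then have "act P (b (j, i, 0)) = 0" using kill[OF ji] by (rule poly_module.dvd_scale_eq_0)
      then have "b (j, i, 0) \<in> annihilated act UNIV P" by (simp add: annihilated_def)
      then have "act (Polynomial.monom 1 a) (b (j, i, 0)) \<in> annihilated act UNIV P"
        by (rule poly_module.subspace_scale[OF sub])
      then show ?thesis using iter[of j i a] d by (simp add: d_eq act_monom)
    qed
    then have "coord.span (b ` ?D) \<subseteq> annihilated act UNIV P"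
      using sub by (intro coord.span_minimal) (auto simp: poly_subspace_iff)
    then show ?thesis by (simp add: gen)
  qed
  then have root: "X \<in> roots n"
    using X(1) poly_mat_eq_0_iff[OF X(1)] by (auto simp: roots_def P_def annihilated_def)
  define v where "v = (\<lambda>j\<in>J. map (\<lambda>i. b (j, i, 0)) [0..<\<nu> j])"
  have set_v: "set (v j) = {b (j, i, 0) | i. i < \<nu> j}" if "j \<in> J" for j
    using that by (auto simp: v_def)
  have comp: "set (v j) \<subseteq> component n X (Q j)" if j: "j \<in> J" for j
    using kill[OF j] bV j degree_Q_pos by (auto simp: set_v annihilated_def idx)
  have span: "?V \<subseteq> poly_module.span (\<Union>j\<in>J. set (v j))"
  proof -
    let ?W = "poly_module.span (\<Union>j\<in>J. set (v j))"
    have "b d \<in> ?W" if d: "d \<in> ?D" for d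
    proof -
      obtain j i a where d_eq: "d = (j, i, a)" by (cases d)
      then have ji: "j \<in> J" "i < \<nu> j" using d idx by auto
      then have "b (j, i, 0) \<in> ?W" by (intro poly_module.span_base) (auto simp: set_v)
      then have "act (Polynomial.monom 1 a) (b (j, i, 0)) \<in> ?W" by (rule poly_module.span_scale)
      then show ?thesis using iter[of j i a] d by (simp add: d_eq act_monom)
    qed
    then have "coord.span (b ` ?D) \<subseteq> ?W"
      using poly_module.subspace_span by (intro coord.span_minimal) (auto simp: poly_subspace_iff)
    then show ?thesis by (simp add: gen)
  qed
  have "v \<in> generating_families n X \<nu>"
    unfolding generating_families_def
  proof (rule PiE_I)
    fix j assume j: "j \<in> J"
    show "v j \<in> generators n X (Q j) (\<nu> j)"
      using span_component_of_generators[OF root comp span j] comp[OF j] j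
      by (simp add: generating_lists_def v_def)
  qed (simp add: v_def)
  moreover have "orbit_family n \<nu> (X, v) = b"
  proof
    fix d
    show "orbit_family n \<nu> (X, v) d = b d"
    proof (cases "d \<in> ?D")
      case True
      obtain j i a where "d = (j, i, a)" by (cases d)
      then show ?thesis using True iter[of j i a] by (simp add: orbit_family_def v_def idx)
    next
      case False
      then show ?thesis using PiE_arb[OF bE False] by (simp add: orbit_family_def)
    qed
  qed
  ultimately show ?thesis using root by blast
qed

lemma sum_card_generating_families:
  assumes "dimension \<nu> = n"
  shows "(\<Sum>X\<in>roots n. card (generating_families n X \<nu>)) = generator_count 1 n"
proof -
  let ?S = "SIGMA X:roots n. generating_families n X \<nu>"
  have "orbit_family n \<nu> ` ?S = spanning_families n \<nu>"
  proof (intro equalityI subsetI)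
    fix b assume "b \<in> spanning_families n \<nu>"
    then show "b \<in> orbit_family n \<nu> ` ?S"
      using spanning_family_is_orbit_family[OF _ assms] by force
  qed (use orbit_family_in_spanning_families in auto)
  then have "card ?S = generator_count 1 n"
    using card_image[OF inj_on_orbit_family, of n \<nu>] card_spanning_families[OF assms] by simp
  moreover have "finite (roots n)" by (rule finite_subset[OF _ finite_carrier_mat[of n n]]) (auto simp: roots_def)
  moreover have "finite (generating_families n X \<nu>)" for X
  proof -
    have "finite (generators n X (Q j) m)" for j m
      by (rule finite_subset[OF _ finite_lists_length_eq[OF finite_space[of n], of m]])
        (auto simp: module_endomorphism.generating_lists_def[OF module_endomorphism_matrix_map] annihilated_def)
    then show ?thesis unfolding generating_families_def using finite_J by (intro finite_PiE) auto
  qed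
  ultimately show ?thesis by (simp add: card_SigmaI)
qed

text \<open>
  Each root has families of generating lists for exactly one \<open>\<nu>\<close>. Weighting a pair with the inverse
  of the number of families of its root therefore counts each root once.
\<close>

theorem card_roots:
  "real (card (roots n)) = (\<Sum>\<nu> | \<nu> \<in> J \<rightarrow>\<^sub>E UNIV \<and> dimension \<nu> = n.
     real (generator_count 1 n) / (\<Prod>j\<in>J. real (generator_count (Polynomial.degree (Q j)) (\<nu> j))))"
proof -
  let ?N = "{\<nu> \<in> J \<rightarrow>\<^sub>E UNIV. dimension \<nu> = n}"
  let ?c = "\<lambda>\<nu>. \<Prod>j\<in>J. real (generator_count (Polynomial.degree (Q j)) (\<nu> j))"
  have "?N \<subseteq> J \<rightarrow>\<^sub>E {..n}"
  proof (rule subsetI)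
    fix \<nu> assume \<nu>: "\<nu> \<in> ?N"
    have "\<nu> j \<le> n" if j: "j \<in> J" for j
    proof -
      have "\<nu> j \<le> \<nu> j * Polynomial.degree (Q j)"
        using mult_le_mono2[of 1 "Polynomial.degree (Q j)" "\<nu> j"] degree_Q_pos[OF j] by linarith
      also have "\<dots> \<le> n" using \<nu> member_le_sum[OF j, of "\<lambda>j. \<nu> j * Polynomial.degree (Q j)"] finite_J by simp
      finally show ?thesis .
    qed
    then show "\<nu> \<in> J \<rightarrow>\<^sub>E {..n}" using \<nu> by (auto simp: PiE_iff)
  qed
  then have finN: "finite ?N" by (rule finite_subset) (intro finite_PiE finite_J finite_atMost)
  have c_pos: "?c \<nu> \<noteq> 0" for \<nu>
    using finite_J generator_count_pos degree_Q_pos by (simp add: prod_zero_iff)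
  have one: "(\<Sum>\<nu>\<in>?N. real (card (generating_families n X \<nu>)) / ?c \<nu>) = 1" if X: "X \<in> roots n" for X
  proof -
    have "\<exists>r. r \<in> J \<rightarrow>\<^sub>E UNIV \<and> dimension r = n \<and>
      (\<forall>\<nu>\<in>J \<rightarrow>\<^sub>E UNIV. dimension \<nu> = n \<longrightarrow> card (generating_families n X \<nu>)
      = (if \<nu> = r then \<Prod>j\<in>J. generator_count (Polynomial.degree (Q j)) (\<nu> j) else 0))"
      using ex_type[OF X] unfolding Bex_def .
    then obtain r where "r \<in> J \<rightarrow>\<^sub>E UNIV \<and> dimension r = n \<and>
      (\<forall>\<nu>\<in>J \<rightarrow>\<^sub>E UNIV. dimension \<nu> = n \<longrightarrow> card (generating_families n X \<nu>)
      = (if \<nu> = r then \<Prod>j\<in>J. generator_count (Polynomial.degree (Q j)) (\<nu> j) else 0))"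
      by (rule exE)
    then have r: "r \<in> ?N" "\<And>\<nu>. \<nu> \<in> ?N \<Longrightarrow> card (generating_families n X \<nu>)
      = (if \<nu> = r then \<Prod>j\<in>J. generator_count (Polynomial.degree (Q j)) (\<nu> j) else 0)"
      by simp_all
    have "(\<Sum>\<nu>\<in>?N. real (card (generating_families n X \<nu>)) / ?c \<nu>) = (\<Sum>\<nu>\<in>?N. if \<nu> = r then 1 else 0)"
      using r(2) c_pos by (intro sum.cong refl) (simp add: of_nat_prod)
    then show ?thesis using r(1) finN by simp
  qed
  have "real (card (roots n)) = (\<Sum>X\<in>roots n. \<Sum>\<nu>\<in>?N. real (card (generating_families n X \<nu>)) / ?c \<nu>)"
    using one by simp
  also have "\<dots> = (\<Sum>\<nu>\<in>?N. \<Sum>X\<in>roots n. real (card (generating_families n X \<nu>)) / ?c \<nu>)"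
    by (rule sum.swap)
  also have "\<dots> = (\<Sum>\<nu>\<in>?N. real (generator_count 1 n) / ?c \<nu>)"
  proof (rule sum.cong[OF refl])
    fix \<nu> assume "\<nu> \<in> ?N"
    then show "(\<Sum>X\<in>roots n. real (card (generating_families n X \<nu>)) / ?c \<nu>) = real (generator_count 1 n) / ?c \<nu>"
      using sum_card_generating_families[of \<nu> n] by (simp flip: sum_divide_distrib of_nat_sum)
  qed
  finally show ?thesis .
qed

theorem card_roots_explicit:
  "real (card (roots n)) = real q ^ (k * n\<^sup>2) * (\<Prod>i=1..n. 1 - 1 / real q ^ i) *
    (\<Sum>\<nu> \<in> {\<nu> \<in> J \<rightarrow>\<^sub>E UNIV. dimension \<nu> = n}.
      \<Prod>j\<in>J. 1 / (real q ^ (k * Polynomial.degree (Q j) * (\<nu> j)\<^sup>2) *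
        (\<Prod>i=1..\<nu> j. 1 - 1 / real q ^ (i * Polynomial.degree (Q j)))))"
proof -
  have top: "real (generator_count 1 n) = real q ^ (k * n\<^sup>2) * (\<Prod>i=1..n. 1 - 1 / real q ^ i)"
    using generator_count_eq[of 1 n] by simp
  have "real (generator_count 1 n) / (\<Prod>j\<in>J. real (generator_count (Polynomial.degree (Q j)) (\<nu> j)))
    = real (generator_count 1 n) *
      (\<Prod>j\<in>J. 1 / (real q ^ (k * Polynomial.degree (Q j) * (\<nu> j)\<^sup>2) *
        (\<Prod>i=1..\<nu> j. 1 - 1 / real q ^ (i * Polynomial.degree (Q j)))))" for \<nu>
  proof -
    have "(\<Prod>j\<in>J. 1 / (real q ^ (k * Polynomial.degree (Q j) * (\<nu> j)\<^sup>2) *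
        (\<Prod>i=1..\<nu> j. 1 - 1 / real q ^ (i * Polynomial.degree (Q j)))))
      = (\<Prod>j\<in>J. 1 / real (generator_count (Polynomial.degree (Q j)) (\<nu> j)))"
      using degree_Q_pos by (intro prod.cong refl) (simp only: generator_count_eq)
    then show ?thesis by (simp add: prod_dividef)
  qed
  then show ?thesis unfolding card_roots sum_distrib_left top by simp
qed

end

section \<open>Residue rings of the integers\<close>

lemma of_int_mod_ring_eq_iff:
  "(of_int i :: 'a::nontriv mod_ring) = of_int j \<longleftrightarrow> i mod int CARD('a) = j mod int CARD('a)"
  unfolding of_int_of_int_mod_ring by transfer simp

lemma to_int_mod_ring_of_int:
  "to_int_mod_ring (of_int i :: 'a::nontriv mod_ring) = i mod int CARD('a)"
  unfolding of_int_of_int_mod_ring by transfer simp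

lemma of_int_to_int_mod_ring: "of_int (to_int_mod_ring x) = (x :: 'a::nontriv mod_ring)"
  unfolding of_int_of_int_mod_ring by simp

text \<open>
  As every element of a residue ring is the class of an integer, this equation lets the properties of
  \<open>reduce\<close> follow from those of \<open>of_int\<close>.
\<close>

lemma reduce_of_int:
  assumes "CARD('b::nontriv) dvd CARD('a::nontriv)"
  shows "reduce (of_int i :: 'a mod_ring) = (of_int i :: 'b mod_ring)"
proof -
  have "int CARD('b) dvd int CARD('a)" using assms by simp
  then show ?thesis
    by (simp add: reduce_def to_int_mod_ring_of_int of_int_mod_ring_eq_iff mod_mod_cancel)
qed

lemma chain_residue_reduce:
  fixes p k :: nat
  assumes "k \<ge> 1" and card_a: "CARD('a::nontriv) = p ^ k" and card_b: "CARD('b::prime_card) = p"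
  shows "chain_residue (reduce :: 'a mod_ring \<Rightarrow> 'b mod_ring) (of_nat p) k p"
proof -
  let ?r = "reduce :: 'a mod_ring \<Rightarrow> 'b mod_ring"
  have "CARD('b) dvd CARD('a)" using assms by (cases k) auto
  note red = reduce_of_int[OF this]
  have ex_int: "\<exists>i. x = of_int i" for x :: "'c::nontriv mod_ring" using of_int_to_int_mod_ring by metis
  have p0: "(of_nat p :: 'b mod_ring) = 0" using card_b of_nat_card_eq_0 by metis
  show ?thesis
  proof unfold_locales
    fix x y :: "'a mod_ring"
    obtain i j where "x = of_int i" "y = of_int j" using ex_int by metis
    then show "?r (x + y) = ?r x + ?r y" "?r (x * y) = ?r x * ?r y"
      by (simp_all add: red flip: of_int_add of_int_mult)
  next
    show "?r 1 = 1" using red[of 1] by simp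
    show "?r 0 = 0" using red[of 0] by simp
    show "surj ?r" unfolding surj_def using red ex_int by metis
    show "of_nat p ^ k = (0 :: 'a mod_ring)"
      using card_a of_nat_card_eq_0[where 'a = 'a] by simp
    show "CARD('b mod_ring) = p" "CARD('a mod_ring) = p ^ k" using assms by simp_all
    fix x :: "'a mod_ring"
    obtain i where i: "x = of_int i" using ex_int by metis
    show "?r x = 0 \<longleftrightarrow> of_nat p dvd x"
    proof
      assume "?r x = 0"
      then have "(of_int i :: 'b mod_ring) = of_int 0" using i red by simp
      then have "int p dvd i" unfolding of_int_mod_ring_eq_iff card_b by (simp add: dvd_eq_mod_eq_0)
      then obtain c where "i = int p * c" by (rule dvdE)
      then have "x = of_nat p * of_int c" using i by simp
      then show "of_nat p dvd x" by simp
    next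
      assume "of_nat p dvd x"
      then obtain y where y: "x = of_nat p * y" by (rule dvdE)
      obtain c where "y = of_int c" using ex_int by metis
      then have "x = of_int (int p * c)" using y by simp
      then have "?r x = of_int (int p * c)" by (simp only: red)
      then show "?r x = 0" by (simp add: p0)
    qed
  qed
qed

theorem theorem1p1:
  fixes p k :: nat
    and P :: "'a::nontriv mod_ring poly"
  assumes "prime p" and "k \<ge> 1"
    and "CARD('a) = p ^ k"
    and "CARD('b::prime_card) = p"
    and "lead_coeff P = 1"
    and "squarefree (reduce_poly P :: 'b mod_ring poly)"
  shows "(\<exists>l Q. hensel_factorization TYPE('b) P l Q) \<and>
    (\<forall>l Q. hensel_factorization TYPE('b) P l Q \<longrightarrow> (\<forall>n::nat. n \<ge> 1 \<longrightarrow>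
      real (card {X \<in> carrier_mat n n. poly_mat P X = 0\<^sub>m n n}) =
        real p ^ (k * n\<^sup>2) * (\<Prod>i=1..n. 1 - 1 / real p ^ i) *
        (\<Sum>\<nu> \<in> {\<nu> \<in> {1..l} \<rightarrow>\<^sub>E (UNIV :: nat set). (\<Sum>j=1..l. \<nu> j * Polynomial.degree (Q j)) = n}.
          \<Prod>j=1..l. 1 / (real p ^ (k * Polynomial.degree (Q j) * (\<nu> j)\<^sup>2) *
            (\<Prod>i=1..\<nu> j. 1 - 1 / real p ^ (i * Polynomial.degree (Q j))))) \<and>
      measure_pmf.prob (pmf_of_set (carrier_mat n n)) {X. poly_mat P X = 0\<^sub>m n n} =
        (\<Prod>i=1..n. 1 - 1 / real p ^ i) *
        (\<Sum>\<nu> \<in> {\<nu> \<in> {1..l} \<rightarrow>\<^sub>E (UNIV :: nat set). (\<Sum>j=1..l. \<nu> j * Polynomial.degree (Q j)) = n}.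
          \<Prod>j=1..l. 1 / (real p ^ (k * Polynomial.degree (Q j) * (\<nu> j)\<^sup>2) *
            (\<Prod>i=1..\<nu> j. 1 - 1 / real p ^ (i * Polynomial.degree (Q j)))))))"
proof -
  let ?red = "reduce :: 'a mod_ring \<Rightarrow> 'b mod_ring"
  interpret chain_residue ?red "of_nat p" k p
    using assms(2-4) by (rule chain_residue_reduce)
  have ex: "\<exists>l Q. hensel_factorization TYPE('b) P l Q"
    using ex_factorization[OF assms(5)] assms(6)
    unfolding hensel_factorization_def reduce_poly_def by blast
  show ?thesis
  proof (intro conjI[OF ex] allI impI)
    fix l Q and n :: nat
    assume "hensel_factorization TYPE('b) P l Q" and "n \<ge> 1"
    then have H: "P = (\<Prod>j=1..l. Q j)" "\<And>j. j \<in> {1..l} \<Longrightarrow> lead_coeff (Q j) = 1"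
        "\<And>j. j \<in> {1..l} \<Longrightarrow> Factorial_Ring.irreducible (red_poly (Q j))"
        "inj_on (\<lambda>j. red_poly (Q j)) {1..l}"
      by (simp_all add: hensel_factorization_def reduce_poly_def)
    interpret factored_polynomial ?red "of_nat p" k p "{1..l}" Q
      by unfold_locales (use H in auto)
    let ?R = "{X \<in> carrier_mat n n. poly_mat P X = 0\<^sub>m n n}"
    let ?\<Phi> = "\<Prod>i=1..n. 1 - 1 / real p ^ i"
    let ?\<Sigma> = "\<Sum>\<nu> \<in> {\<nu> \<in> {1..l} \<rightarrow>\<^sub>E (UNIV :: nat set). (\<Sum>j=1..l. \<nu> j * Polynomial.degree (Q j)) = n}.
          \<Prod>j=1..l. 1 / (real p ^ (k * Polynomial.degree (Q j) * (\<nu> j)\<^sup>2) *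
            (\<Prod>i=1..\<nu> j. 1 - 1 / real p ^ (i * Polynomial.degree (Q j))))"
    have count: "real (card ?R) = real p ^ (k * n\<^sup>2) * ?\<Phi> * ?\<Sigma>"
      using card_roots_explicit[of n] by (simp only: roots_def H(1)[symmetric])
    have carrier: "finite (carrier_mat n n :: 'a mod_ring mat set)"
        "card (carrier_mat n n :: 'a mod_ring mat set) = p ^ (k * n\<^sup>2)"
      by (simp_all add: finite_carrier_mat card_carrier_mat assms(3) power_mult power2_eq_square)
    have "measure_pmf.prob (pmf_of_set (carrier_mat n n)) {X. poly_mat P X = 0\<^sub>m n n}
        = real (card ?R) / real p ^ (k * n\<^sup>2)"
    proof -
      have "(carrier_mat n n :: 'a mod_ring mat set) \<noteq> {}" using zero_carrier_mat by blast
      then show ?thesis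
        using carrier by (simp add: measure_pmf_of_set Int_def)
    qed
    also have "\<dots> = ?\<Phi> * ?\<Sigma>" unfolding count using q_gt_1 by simp
    finally show "real (card ?R) = real p ^ (k * n\<^sup>2) * ?\<Phi> * ?\<Sigma> \<and>
      measure_pmf.prob (pmf_of_set (carrier_mat n n)) {X. poly_mat P X = 0\<^sub>m n n} = ?\<Phi> * ?\<Sigma>"
      using count by blast
  qed
qed

end
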